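(* Let $\sigma>0$ and let $(\psi,\vartheta)$ be a $\sigma$-periodic cocycle in a real separable Hilbert space $\mathbb{H}$. Suppose: (i) $P\colon\mathbb{H}\to\mathbb{H}$ is a bounded self-adjoint linear operator and $\mathbb{H}=\mathbb{H}^{+}\oplus\mathbb{H}^{-}$ is an orthogonal direct sum of $P$-invariant subspaces with $P|_{\mathbb{H}^{-}}<0$ and $P|_{\mathbb{H}^{+}}>0$; (ii) $\dim\mathbb{H}^{-}=2$; (iii) with $V(u):=(Pu,u)$ there are numbers $\delta>0$ and $\nu>0$ such that $$e^{2\nu r}V(\psi^{r}(q,u)-\psi^{r}(q,v))-e^{2\nu l}V(\psi^{l}(q,u)-\psi^{l}(q,v))\le-\delta\int_{l}^{r}e^{2\nu s}|\psi^{s}(q,u)-\psi^{s}(q,v)|^{2}ds$$ for all $u,v\in\mathbb{H}$, $q\in\mathcal{Q}$ and $0\le l\le r$; (iv) either $P$ is compact, or there exists $t_{com}>0$ such that the map $\psi^{t_{com}}(q,\cdot)\colon\mathbb{H}\to\mathbb{H}$ is compact for every $q\in\mathcal{Q}$. If there exists a bounded semi-trajectory $u(t)=\psi^{t}(q,u_0)$, $t\ge0$, at some $q\in\mathcal{Q}$, then there exists a $\sigma$-periodic trajectory.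
   Context: A cocycle $(\psi,\vartheta)$ in $\mathbb{H}$ over a flow $\{\vartheta^t\}_{t\in\mathbb{R}}$ on a metric space $\mathcal{Q}$ is a family of maps $\psi^{t}\colon\mathcal{Q}\times\mathbb{H}\to\mathbb{H}$, $t\ge0$, such that $\psi^{0}(q,u)=u$; $\psi^{t+s}(q,u)=\psi^{t}(\vartheta^{s}(q),\psi^{s}(q,u))$ for all $u,q$ and $t,s\ge0$; and $(t,q,u)\mapsto\psi^{t}(q,u)$ is continuous on $\mathbb{R}_{+}\times\mathcal{Q}\times\mathbb{H}$. It is $\sigma$-periodic if $\mathcal{Q}=\mathbb{R}/\sigma\mathbb{Z}$ and $\vartheta^{t}(\theta)=\theta+t$. $P|_{E}<0$ (resp. $>0$) means $(Pu,u)<0$ (resp. $>0$) for all non-zero $u\in E$. A (possibly nonlinear) compact map sends bounded sets to relatively compact sets. A complete trajectory at $q$ is a continuous map $u\colon\mathbb{R}\to\mathbb{H}$ with $u(t+s)=\psi^{t}(\vartheta^{s}(q),u(s))$ for all $t\ge0$, $s\in\mathbb{R}$; it is a $\sigma$-periodic trajectory if moreover $u(t+\sigma)=u(t)$ for all $t$. *)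

theory Defs
  imports "HOL-Analysis.Analysis"
begin

section \<open>Flows and cocycles\<close>

definition is_flow :: "'q metric \<Rightarrow> (real \<Rightarrow> 'q \<Rightarrow> 'q) \<Rightarrow> bool" where
  "is_flow Q \<theta> \<longleftrightarrow>
     (\<forall>t. \<forall>q\<in>mspace Q. \<theta> t q \<in> mspace Q) \<and>
     (\<forall>q\<in>mspace Q. \<theta> 0 q = q) \<and>
     (\<forall>t s. \<forall>q\<in>mspace Q. \<theta> (t + s) q = \<theta> t (\<theta> s q)) \<and>
     continuous_map (prod_topology euclideanreal (mtopology_of Q)) (mtopology_of Q)
       (\<lambda>(t, q). \<theta> t q)"

definition is_cocycle ::
  "'q metric \<Rightarrow> (real \<Rightarrow> 'q \<Rightarrow> 'q) \<Rightarrow> (real \<Rightarrow> 'q \<Rightarrow> 'h \<Rightarrow> 'h::topological_space) \<Rightarrow> bool" where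
  "is_cocycle Q \<theta> \<psi> \<longleftrightarrow>
     is_flow Q \<theta> \<and>
     (\<forall>q\<in>mspace Q. \<forall>u. \<psi> 0 q u = u) \<and>
     (\<forall>q\<in>mspace Q. \<forall>u. \<forall>t\<ge>0. \<forall>s\<ge>0. \<psi> (t + s) q u = \<psi> t (\<theta> s q) (\<psi> s q u)) \<and>
     continuous_map
       (prod_topology (top_of_set {0..}) (prod_topology (mtopology_of Q) euclidean)) euclidean
       (\<lambda>(t, q, u). \<psi> t q u)"

definition is_complete_trajectory ::
  "(real \<Rightarrow> 'q \<Rightarrow> 'q) \<Rightarrow> (real \<Rightarrow> 'q \<Rightarrow> 'h \<Rightarrow> 'h::topological_space) \<Rightarrow> 'q \<Rightarrow> (real \<Rightarrow> 'h) \<Rightarrow> bool"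
where
  "is_complete_trajectory \<theta> \<psi> q u \<longleftrightarrow>
     continuous_on UNIV u \<and> (\<forall>t\<ge>0. \<forall>s. u (t + s) = \<psi> t (\<theta> s q) (u s))"

definition is_periodic_trajectory ::
  "real \<Rightarrow> (real \<Rightarrow> 'q \<Rightarrow> 'q) \<Rightarrow> (real \<Rightarrow> 'q \<Rightarrow> 'h \<Rightarrow> 'h::topological_space) \<Rightarrow> 'q \<Rightarrow> (real \<Rightarrow> 'h) \<Rightarrow> bool"
where
  "is_periodic_trajectory \<sigma> \<theta> \<psi> q u \<longleftrightarrow>
     is_complete_trajectory \<theta> \<psi> q u \<and> (\<forall>t. u (t + \<sigma>) = u t)"


section \<open>The circle of length \<open>\<sigma>\<close>\<close>

text \<open>Points of \<open>\<real>/\<sigma>\<int>\<close> are the cosets \<open>x + \<sigma>\<int>\<close>, as sets of reals; \<open>setdist\<close> restricted to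
  cosets is the usual quotient metric.\<close>

definition circle_coset :: "real \<Rightarrow> real \<Rightarrow> real set" where
  "circle_coset \<sigma> x = {x + \<sigma> * of_int k | k. True}"

definition circle :: "real \<Rightarrow> real set metric" where
  "circle \<sigma> = metric (range (circle_coset \<sigma>), setdist)"

definition is_periodic_cocycle ::
  "real \<Rightarrow> (real \<Rightarrow> real set \<Rightarrow> real set) \<Rightarrow>
   (real \<Rightarrow> real set \<Rightarrow> 'h \<Rightarrow> 'h::topological_space) \<Rightarrow> bool" where
  "is_periodic_cocycle \<sigma> \<theta> \<psi> \<longleftrightarrow>
     is_cocycle (circle \<sigma>) \<theta> \<psi> \<and>
     (\<forall>t x. \<theta> t (circle_coset \<sigma> x) = circle_coset \<sigma> (x + t))"

lemma circle_coset_nonempty [simp]: "circle_coset \<sigma> x \<noteq> {}"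
  by (auto simp: circle_coset_def)

lemma circle_coset_self: "x \<in> circle_coset \<sigma> x"
  unfolding circle_coset_def by (auto intro!: exI[of _ 0])

lemma circle_coset_eqI:
  assumes "y \<in> circle_coset \<sigma> x"
  shows "circle_coset \<sigma> y = circle_coset \<sigma> x"
proof -
  obtain k where k: "y = x + \<sigma> * of_int k"
    using assms by (auto simp: circle_coset_def)
  have "\<exists>j'. y + \<sigma> * of_int j = x + \<sigma> * of_int j'" for j
    by (rule exI[of _ "k + j"]) (simp add: k algebra_simps)
  moreover have "\<exists>j'. x + \<sigma> * of_int j = y + \<sigma> * of_int j'" for j
    by (rule exI[of _ "j - k"]) (simp add: k algebra_simps)
  ultimately show ?thesis
    unfolding circle_coset_def by auto
qed

lemma circle_coset_add: "circle_coset \<sigma> (x + t) = (\<lambda>y. y + t) ` circle_coset \<sigma> x"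
  unfolding circle_coset_def by (auto simp: image_iff algebra_simps)

lemma closed_circle_coset:
  assumes "\<sigma> > 0"
  shows "closed (circle_coset \<sigma> x)"
proof -
  have "circle_coset \<sigma> x = (\<lambda>y. (y - x) / \<sigma>) -` \<int>"
  proof (intro set_eqI iffI)
    fix y assume "y \<in> (\<lambda>y. (y - x) / \<sigma>) -` \<int>"
    then obtain k where "(y - x) / \<sigma> = of_int k"
      by (auto elim: Ints_cases)
    then have "y = x + \<sigma> * of_int k"
      using assms by (simp add: field_simps)
    then show "y \<in> circle_coset \<sigma> x"
      by (auto simp: circle_coset_def)
  qed (use assms in \<open>auto simp: circle_coset_def\<close>)
  moreover have "closed ((\<lambda>y. (y - x) / \<sigma>) -` (\<int> :: real set))"
    using assms by (intro closed_vimage closed_Ints continuous_intros) auto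
  ultimately show ?thesis by simp
qed

lemma setdist_circle_coset:
  assumes "a \<in> circle_coset \<sigma> x"
  shows "setdist (circle_coset \<sigma> x) (circle_coset \<sigma> y) = infdist a (circle_coset \<sigma> y)"
proof (rule antisym)
  let ?A = "circle_coset \<sigma> x" and ?B = "circle_coset \<sigma> y"
  show "setdist ?A ?B \<le> infdist a ?B"
    using assms by (simp add: infdist_def) (intro cINF_greatest setdist_le_dist, auto)
  show "infdist a ?B \<le> setdist ?A ?B"
  proof (rule le_setdistI)
    fix a' b assume "a' \<in> ?A" "b \<in> ?B"
    then have "circle_coset \<sigma> a' = circle_coset \<sigma> a" and "circle_coset \<sigma> b = ?B"
      using assms circle_coset_eqI by metis+
    then have "a \<in> circle_coset \<sigma> a'"
      using circle_coset_self[of a \<sigma>] by simp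
    then obtain k where k: "a = a' + \<sigma> * of_int k"
      by (auto simp: circle_coset_def)
    have "b + \<sigma> * of_int k \<in> circle_coset \<sigma> b"
      by (auto simp: circle_coset_def)
    then have "b + \<sigma> * of_int k \<in> ?B"
      by (simp only: \<open>circle_coset \<sigma> b = ?B\<close>)
    then have "infdist a ?B \<le> dist a (b + \<sigma> * of_int k)"
      by (rule infdist_le)
    also have "\<dots> = dist a' b"
      by (simp add: k dist_real_def)
    finally show "infdist a ?B \<le> dist a' b" .
  qed simp_all
qed

lemma Metric_space_circle:
  assumes "\<sigma> > 0"
  shows "Metric_space (range (circle_coset \<sigma>)) setdist"
proof
  fix A B :: "real set"
  show "0 \<le> setdist A B" by (rule setdist_pos_le)
  show "setdist A B = setdist B A" by (rule setdist_sym)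
  assume "A \<in> range (circle_coset \<sigma>)" "B \<in> range (circle_coset \<sigma>)"
  then obtain x y where A: "A = circle_coset \<sigma> x" and B: "B = circle_coset \<sigma> y" by auto
  have "setdist A B = 0 \<longleftrightarrow> x \<in> B"
    using in_closed_iff_infdist_zero[OF closed_circle_coset[OF assms], of y x]
    by (simp add: A B setdist_circle_coset[OF circle_coset_self])
  also have "\<dots> \<longleftrightarrow> A = B"
    using A B circle_coset_eqI circle_coset_self by blast
  finally show "setdist A B = 0 \<longleftrightarrow> A = B" .
next
  fix A B C :: "real set"
  assume "A \<in> range (circle_coset \<sigma>)" "B \<in> range (circle_coset \<sigma>)" "C \<in> range (circle_coset \<sigma>)"
  then obtain x y z
    where A: "A = circle_coset \<sigma> x" and B: "B = circle_coset \<sigma> y" and C: "C = circle_coset \<sigma> z"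
    by auto
  obtain b where b: "b \<in> B" "infdist x B = dist x b"
    using infdist_attains_inf[OF closed_circle_coset[OF assms], of y x] B by auto
  have "infdist x C \<le> infdist b C + dist x b"
    by (rule infdist_triangle)
  then show "setdist A C \<le> setdist A B + setdist B C"
    using b(2) unfolding A B C setdist_circle_coset[OF circle_coset_self[of x]]
      setdist_circle_coset[OF b(1)[unfolded B]]
    by simp
qed

lemma mspace_circle [simp]: "\<sigma> > 0 \<Longrightarrow> mspace (circle \<sigma>) = range (circle_coset \<sigma>)"
  unfolding circle_def by (rule Metric_space.mspace_metric[OF Metric_space_circle])

lemma mdist_circle [simp]: "\<sigma> > 0 \<Longrightarrow> mdist (circle \<sigma>) = setdist"
  unfolding circle_def by (rule Metric_space.mdist_metric[OF Metric_space_circle])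

lemma is_flow_circle:
  assumes "\<sigma> > 0"
  shows "is_flow (circle \<sigma>) (\<lambda>t q. (\<lambda>y. y + t) ` q)"
proof -
  interpret Metric_space "range (circle_coset \<sigma>)" setdist
    by (rule Metric_space_circle[OF assms])
  have top: "mtopology_of (circle \<sigma>) = mtopology"
    by (simp add: circle_def)
  have "continuous_map (prod_topology euclideanreal mtopology) mtopology (\<lambda>(t, q). (\<lambda>y. y + t) ` q)"
    unfolding continuous_map_to_metric
  proof (intro ballI allI impI)
    fix p :: "real \<times> real set" and e :: real
    assume "p \<in> topspace (prod_topology euclideanreal mtopology)" and e: "e > 0"
    then obtain t x where p: "p = (t, circle_coset \<sigma> x)" by auto
    let ?U = "ball t (e/2) \<times> mball (circle_coset \<sigma> x) (e/2)"
    have "openin (prod_topology euclideanreal mtopology) ?U"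
      by (simp add: openin_prod_Times_iff)
    moreover have "p \<in> ?U"
      using e by (simp add: p)
    moreover have "(case r of (t, q) \<Rightarrow> (\<lambda>y. y + t) ` q)
                     \<in> mball (case p of (t, q) \<Rightarrow> (\<lambda>y. y + t) ` q) e"
      if r: "r \<in> ?U" for r
    proof -
      obtain s y where r_eq: "r = (s, circle_coset \<sigma> y)" and s: "dist t s < e/2"
        and d: "setdist (circle_coset \<sigma> x) (circle_coset \<sigma> y) < e/2"
        using r by (auto simp: mball_def)
      obtain b where b: "b \<in> circle_coset \<sigma> y" "infdist x (circle_coset \<sigma> y) = dist x b"
        using infdist_attains_inf[OF closed_circle_coset[OF assms], of y x] by auto
      have "setdist (circle_coset \<sigma> (x + t)) (circle_coset \<sigma> (y + s)) \<le> dist (x + t) (b + s)"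
        using b(1) by (intro setdist_le_dist circle_coset_self) (auto simp: circle_coset_add)
      also have "\<dots> \<le> dist x b + dist t s"
        by (simp add: dist_real_def)
      also have "\<dots> < e"
        using s d b(2) setdist_circle_coset[OF circle_coset_self, of \<sigma> x y] by simp
      finally show ?thesis
        by (simp add: p r_eq flip: circle_coset_add)
    qed
    ultimately show "\<exists>U. openin (prod_topology euclideanreal mtopology) U \<and> p \<in> U \<and>
        (\<forall>r\<in>U. (case r of (t, q) \<Rightarrow> (\<lambda>y. y + t) ` q)
                  \<in> mball (case p of (t, q) \<Rightarrow> (\<lambda>y. y + t) ` q) e)"
      by blast
  qed
  moreover have "(\<lambda>y. y + t) ` q \<in> range (circle_coset \<sigma>)" if "q \<in> range (circle_coset \<sigma>)" for t q
    using that by (auto simp flip: circle_coset_add)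
  moreover have "(\<lambda>y. y + (t + s)) ` q = (\<lambda>y. y + t) ` (\<lambda>y. y + s) ` q" for t s and q :: "real set"
    by (simp add: image_image add.assoc add.commute[of s])
  ultimately show ?thesis
    using assms unfolding is_flow_def top by simp
qed


section \<open>Operators and subspaces\<close>

definition self_adjoint :: "('h \<Rightarrow> 'h::real_inner) \<Rightarrow> bool" where
  "self_adjoint P \<longleftrightarrow> (\<forall>x y. P x \<bullet> y = x \<bullet> P y)"

definition orthogonal_direct_sum :: "'h::real_inner set \<Rightarrow> 'h set \<Rightarrow> bool" where
  "orthogonal_direct_sum E F \<longleftrightarrow>
     subspace E \<and> subspace F \<and> (\<forall>x\<in>E. \<forall>y\<in>F. orthogonal x y) \<and>
     {x + y | x y. x \<in> E \<and> y \<in> F} = UNIV"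

definition quad_form :: "('h \<Rightarrow> 'h::real_inner) \<Rightarrow> 'h \<Rightarrow> real" where
  "quad_form P u = P u \<bullet> u"

definition positive_on :: "('h \<Rightarrow> 'h::real_inner) \<Rightarrow> 'h set \<Rightarrow> bool" where
  "positive_on P E \<longleftrightarrow> (\<forall>u\<in>E. u \<noteq> 0 \<longrightarrow> P u \<bullet> u > 0)"

definition negative_on :: "('h \<Rightarrow> 'h::real_inner) \<Rightarrow> 'h set \<Rightarrow> bool" where
  "negative_on P E \<longleftrightarrow> (\<forall>u\<in>E. u \<noteq> 0 \<longrightarrow> P u \<bullet> u < 0)"

definition is_compact_map :: "('a::metric_space \<Rightarrow> 'b::metric_space) \<Rightarrow> bool" where
  "is_compact_map f \<longleftrightarrow> (\<forall>B. bounded B \<longrightarrow> compact (closure (f ` B)))"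

end

theory Submission
  imports Defs
begin

text \<open>
  Write \<open>T = \<psi>\<^sup>\<sigma>(q, \<cdot>)\<close>. The squeezing inequality makes any two distinct points \<open>u, v\<close> that have backward
  orbits growing at most like \<open>e\<^sup>\<nu>\<^sup>t\<close> in mean square satisfy \<open>V(u - v) < 0\<close>, so the set of such points is
  mapped injectively into the two-dimensional space \<open>H\<^sup>-\<close>. It is mapped onto \<open>H\<^sup>-\<close>: the images
  \<open>T\<^sup>N(p + H\<^sup>-)\<close> of affine planes attached to the bounded orbit project onto \<open>H\<^sup>-\<close> by invariance of
  domain, and compactness lets \<open>N\<close> tend to infinity. Thus \<open>T\<close> restricts to an injective continuous map
  of a plane, isotopic to the identity through the maps \<open>\<psi>\<^sup>t\<close>, with a bounded orbit; by Brouwer's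
  translation theorem it has a fixed point.

  For the planar theorem the isotopy is used only through a symmetric continuous logarithm \<open>R(x, y)\<close> of
  \<open>(f x - f y) / (x - y)\<close>. If \<open>f\<close> had no fixed point, a bounded orbit could be closed up to a periodic one
  by a small perturbation, the translates of a translation arc through it would contain a first
  loop, and adding up the arguments of chords of this loop gives \<open>2 M = 0\<close> with \<open>exp M = -1\<close>.
\<close>

section \<open>Planar maps isotopic to the identity\<close>

text \<open>\<open>P\<close> is positive on \<open>H^+\<close> without a uniform gap, so
  \<open>V\<close> does not control the norm there, and squeezing bounds differences of orbits only
  through time integrals. Hence growth and distance are measured in mean square over one period; a
  pointwise statement is obtained at some uncontrolled time of a period and carried to a later time
  by the cocycle maps. Compactness also acts only some periods later, so limits are taken that many
  steps back along an orbit and then iterated forward. The period map need not be injective on the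
  whole space, nor need a point have a preimage; points with slowly growing backward orbits supply
  both. The planar part is in the spirit of Hopf's treatment of the turning of a simple closed
  curve: the chords of a loop are parametrised by a triangle, on which a logarithm exists by
  convexity. Chords of unit time length are displacements of the map, which have a logarithm of
  their own because there is no fixed point.\<close>

lemma exp_lift_convex:
  fixes g :: "'a::real_normed_vector \<Rightarrow> complex"
  assumes "convex S" "continuous_on S g" "\<And>x. x \<in> S \<Longrightarrow> g x \<noteq> 0"
  obtains h where "continuous_on S h" "\<And>x. x \<in> S \<Longrightarrow> exp (h x) = g x"
  using continuous_logarithm_on_contractible[OF assms(2) convex_imp_contractible[OF assms(1)]] assms(3)
  by metis

text \<open>Two logarithms of one number differ by a multiple of \<open>2 pi i\<close>, so distinct
  values of \<open>h\<close> are at least \<open>2 pi\<close> apart and connectedness leaves only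
  one. Logarithms are compared below by applying this to their differences.\<close>

lemma exp_constant_imp_constant:
  fixes h :: "'a::topological_space \<Rightarrow> complex"
  assumes "connected S" "continuous_on S h" "\<And>x. x \<in> S \<Longrightarrow> exp (h x) = w"
    and "x \<in> S" "y \<in> S"
  shows "h x = h y"
proof -
  have "h constant_on S"
  proof (rule continuous_discrete_range_constant[OF assms(1,2)])
    fix x assume x: "x \<in> S"
    have "2 * pi \<le> norm (h y - h x)" if y: "y \<in> S" "h y \<noteq> h x" for y
    proof -
      obtain n :: int where n: "h y = h x + (of_int (2*n) * pi) * \<i>"
        using assms(3)[OF x] assms(3)[OF y(1)] exp_eq[of "h y" "h x"] by auto
      with y have "n \<noteq> 0" by auto
      then have "1 \<le> \<bar>real_of_int n\<bar>" by linarith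
      then show ?thesis by (simp add: n norm_mult)
    qed
    then show "\<exists>e>0. \<forall>y. y \<in> S \<and> h y \<noteq> h x \<longrightarrow> e \<le> norm (h y - h x)"
      using pi_gt_zero by (intro exI[of _ "2 * pi"]) auto
  qed
  then show ?thesis using assms(4,5) by (auto simp: constant_on_def)
qed

text \<open>For an injective continuous \<open>f\<close> such an \<open>R\<close> exists exactly
  when \<open>f\<close> preserves orientation: as \<open>y\<close> circles \<open>x\<close> once,
  the chord \<open>f x - f y\<close> must turn once in the same sense.\<close>

definition rotation_of :: "(complex \<Rightarrow> complex) \<Rightarrow> (complex \<times> complex \<Rightarrow> complex) \<Rightarrow> bool" where
  "rotation_of f R \<longleftrightarrow> continuous_on UNIV f \<and> continuous_on {p. fst p \<noteq> snd p} R \<and>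
     (\<forall>x y. x \<noteq> y \<longrightarrow> R (x, y) = R (y, x) \<and> f x - f y = exp (R (x, y)) * (x - y))"

lemma rotation_of_inj: "rotation_of f R \<Longrightarrow> inj f"
  unfolding rotation_of_def by (metis (no_types, lifting) eq_iff_diff_eq_0 exp_not_eq_zero injI mult_eq_0_iff)

text \<open>The loop is \<open>c\<close> on \<open>[a, b]\<close>; \<open>\<phi>\<close> and \<open>\<xi>\<close> are logarithms of its chords \<open>c t - c s\<close>, and \<open>A\<close> is a
  logarithm of the displacement of \<open>f\<close>. Since \<open>A (f x) - A x\<close> and \<open>R (x, f x)\<close> differ by a constant \<open>K\<close>,
  moving a chord by \<open>f\<close> changes its logarithm by \<open>R + K\<close>. The symmetry of \<open>R\<close> enters at the
  chord from \<open>c (b-1)\<close> to \<open>c b = c a\<close>.\<close>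

lemma no_simple_loop:
  fixes c :: "real \<Rightarrow> complex"
  assumes R: "rotation_of f R" and nofix: "\<And>x. f x \<noteq> x"
    and c: "continuous_on {0..} c" "\<And>t. 0 \<le> t \<Longrightarrow> f (c t) = c (t + 1)"
    and loc: "\<And>s t. 0 \<le> s \<Longrightarrow> s < t \<Longrightarrow> t \<le> s + 1 \<Longrightarrow> c s \<noteq> c t"
    and a: "0 \<le> a" "a < b" "c a = c b" and inj: "inj_on c {0..<b}"
  shows False
proof -
  \<comment> \<open>Points at most one time unit apart are distinct by \<open>loc\<close>, so
    \<open>b - 1\<close> lies strictly inside the loop.\<close>
  have L: "b - a > 1" using loc[OF a(1,2)] a by force
  note f = R[unfolded rotation_of_def, THEN conjunct1]
  note Rc = R[unfolded rotation_of_def, THEN conjunct2, THEN conjunct1]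
  have Rs: "R (x, y) = R (y, x)" and Re: "f x - f y = exp (R (x, y)) * (x - y)" if "x \<noteq> y" for x y
    using R that unfolding rotation_of_def by blast+
  \<comment> \<open>The corner \<open>(a, b)\<close>, where the chord degenerates, is an extreme point of the triangle, so \<open>D1\<close> is convex.
    \<open>D2\<close> is needed because \<open>b - a\<close> may be less than 2, when \<open>D1\<close> contains no chord \<open>(s+1, s+2)\<close>.\<close>
  define D1 where "D1 = {p::real\<times>real. a \<le> fst p \<and> fst p < snd p \<and> snd p \<le> b \<and> snd p - fst p < b - a}"
  define D2 where "D2 = {p::real\<times>real. 0 \<le> fst p \<and> fst p < snd p \<and> snd p \<le> fst p + 1}"
  define D3 where "D3 = {p::real\<times>real. a \<le> fst p \<and> fst p < snd p \<and> snd p \<le> b - 1}"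
  have conv: "convex D1" "convex D2" "convex D3"
  proof -
    have lin: "linear (fst :: real \<times> real \<Rightarrow> real)" "linear (snd :: real \<times> real \<Rightarrow> real)"
      "linear (\<lambda>p::real\<times>real. snd p - fst p)"
      by (auto simp: linear_iff algebra_simps)
    have "D1 = fst -` {a..} \<inter> snd -` {..b} \<inter> (\<lambda>p. snd p - fst p) -` {0<..<b-a}"
      "D2 = fst -` {0..} \<inter> (\<lambda>p. snd p - fst p) -` {0<..1}"
      "D3 = fst -` {a..} \<inter> snd -` {..b-1} \<inter> (\<lambda>p. snd p - fst p) -` {0<..}"
      by (auto simp: D1_def D2_def D3_def)
    then show "convex D1" "convex D2" "convex D3"
      by (simp_all add: convex_Int convex_linear_vimage lin)
  qed
  have cne1: "c s \<noteq> c t" if "(s, t) \<in> D1" for s t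
  proof (cases "t = b")
    case True
    then have "c t = c a" "s \<noteq> a" "s < b" "a \<le> s" using that a by (auto simp: D1_def)
    then show ?thesis using inj_onD[OF inj, of s a] a by auto
  next
    case False
    then show ?thesis using that inj a by (force simp: D1_def dest: inj_onD)
  qed
  have cne2: "c s \<noteq> c t" if "(s, t) \<in> D2" for s t using that loc by (auto simp: D2_def)
  have cc: "continuous_on S (\<lambda>p. c (h p))" if "continuous_on S h" "h ` S \<subseteq> {0..}" for S :: "'z::topological_space set" and h
    by (rule continuous_on_compose2[OF c(1) that])
  obtain \<phi> where \<phi>: "continuous_on D1 \<phi>" "\<And>s t. (s, t) \<in> D1 \<Longrightarrow> exp (\<phi> (s, t)) = c t - c s"
  proof (rule exp_lift_convex[OF conv(1), of "\<lambda>p. c (snd p) - c (fst p)"])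
    show "continuous_on D1 (\<lambda>p. c (snd p) - c (fst p))"
      by (intro continuous_intros cc) (use a in \<open>auto simp: D1_def\<close>)
    show "c (snd x) - c (fst x) \<noteq> 0" if "x \<in> D1" for x
      using cne1[of "fst x" "snd x"] that by auto
  qed (use that in force)
  obtain \<xi> where \<xi>: "continuous_on D2 \<xi>" "\<And>s t. (s, t) \<in> D2 \<Longrightarrow> exp (\<xi> (s, t)) = c t - c s"
  proof (rule exp_lift_convex[OF conv(2), of "\<lambda>p. c (snd p) - c (fst p)"])
    show "continuous_on D2 (\<lambda>p. c (snd p) - c (fst p))"
      by (intro continuous_intros cc) (auto simp: D2_def)
    show "c (snd x) - c (fst x) \<noteq> 0" if "x \<in> D2" for x
      using cne2[of "fst x" "snd x"] that by auto
  qed (use that in force)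
  obtain A where A: "continuous_on UNIV A" "\<And>x. exp (A x) = f x - x"
  proof (rule exp_lift_convex[OF convex_UNIV, of "\<lambda>x. f x - x"])
    show "continuous_on UNIV (\<lambda>x. f x - x)" by (intro continuous_intros f)
  qed (use that nofix in auto)
  define K where "K = A (f 0) - A 0 - R (0, f 0)"
  have K: "A (f x) = A x + R (x, f x) + K" for x
  proof -
    have "A (f x) - A x - R (x, f x) = A (f 0) - A 0 - R (0, f 0)"
    proof (rule exp_constant_imp_constant[OF connected_UNIV, of "\<lambda>x. A (f x) - A x - R (x, f x)" 1])
      show "continuous_on UNIV (\<lambda>x. A (f x) - A x - R (x, f x))"
        by (intro continuous_intros continuous_on_compose2[OF A(1)] continuous_on_compose2[OF Rc] f)
          (use nofix in \<open>auto simp: eq_commute\<close>)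
      show "exp (A (f x) - A x - R (x, f x)) = 1" for x
      proof -
        have "f x \<noteq> x" "f (f x) \<noteq> f x" using nofix by auto
        then have "exp (R (x, f x)) = (f (f x) - f x) / (f x - x)"
          using Re[of "f x" x] Rs[of "f x" x] by (simp add: field_simps)
        then show ?thesis using \<open>f x \<noteq> x\<close> \<open>f (f x) \<noteq> f x\<close> by (simp add: exp_diff A(2))
      qed
    qed auto
    then show ?thesis by (simp add: K_def algebra_simps)
  qed
  have Acont: "continuous_on {0..} (\<lambda>s. A (c s))"
    by (intro continuous_on_compose2[OF A(1)] c) auto
  have s1: "\<xi> (s, s+1) - A (c s) = \<xi> (0, 1) - A (c 0)" if "0 \<le> s" for s
  proof -
    have "\<xi> (s, s+1) - A (c s) = \<xi> (0, 0+1) - A (c 0)"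
    proof (rule exp_constant_imp_constant[of "{0::real..}" "\<lambda>s. \<xi> (s, s+1) - A (c s)" 1])
      show "continuous_on {0..} (\<lambda>s. \<xi> (s, s + 1) - A (c s))"
        by (intro continuous_intros continuous_on_compose2[OF \<xi>(1)] Acont) (auto simp: D2_def)
      show "exp (\<xi> (s, s + 1) - A (c s)) = 1" if "s \<in> {0..}" for s
      proof -
        have "(s, s+1) \<in> D2" using that by (auto simp: D2_def)
        then show ?thesis using that nofix[of "c s"] by (simp add: exp_diff \<xi>(2) A(2) c(2))
      qed
    qed (use that in auto)
    then show ?thesis by simp
  qed
  have Rcont: "continuous_on S (\<lambda>p. R (c (fst p), c (snd p)))"
    if "S \<subseteq> D1 \<union> D2" for S
    by (rule continuous_on_compose2[OF Rc], intro continuous_intros cc)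
       (use that a cne1 cne2 in \<open>force simp: D1_def D2_def\<close>)+
  have Rexp: "exp (R (c s, c t)) = (c (t+1) - c (s+1)) / (c t - c s)" if "0 \<le> s" "0 \<le> t" "c s \<noteq> c t" for s t
    using Re[OF that(3)] c(2)[OF that(1)] c(2)[OF that(2)] that(3) by (auto simp: field_simps)
  \<comment> \<open>\<open>f\<close> shifts both ends of a chord by one time unit. The constant is
    identified at the chord \<open>(0, 1)\<close>, a displacement, where \<open>s1\<close> and
    \<open>K\<close> apply.\<close>
  have s2: "\<xi> (s+1, t+1) - \<xi> (s, t) - R (c s, c t) = K" if "(s, t) \<in> D2" for s t
  proof -
    define H where "H = (\<lambda>p. \<xi> (fst p+1, snd p+1) - \<xi> (fst p, snd p) - R (c (fst p), c (snd p)))"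
    have "H (s, t) = H (0, 1)"
    proof (rule exp_constant_imp_constant[OF convex_connected[OF conv(2)], of H 1])
      show "continuous_on D2 H" unfolding H_def
        by (intro continuous_intros continuous_on_compose2[OF \<xi>(1)] Rcont) (auto simp: D2_def)
      show "exp (H p) = 1" if p: "p \<in> D2" for p
      proof -
        obtain s t where st: "p = (s, t)" by fastforce
        have "(s+1, t+1) \<in> D2" "(s, t) \<in> D2" using p by (auto simp: D2_def st)
        moreover from this have "c s \<noteq> c t" "c (s+1) \<noteq> c (t+1)" using cne2 by auto
        moreover have "0 \<le> s" "0 \<le> t" using p by (auto simp: D2_def st)
        ultimately show ?thesis by (simp add: H_def st exp_diff \<xi>(2) Rexp)
      qed
    qed (use that in \<open>auto simp: D2_def\<close>)
    also have "\<dots> = K"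
    proof -
      have "c 1 = f (c 0)" using c(2)[of 0] by simp
      moreover have "\<xi> (1, 2) - A (c 1) = \<xi> (0, 1) - A (c 0)" using s1[of 1] by simp
      ultimately show ?thesis using K[of "c 0"]
        by (simp add: H_def algebra_simps)
    qed
    finally show ?thesis by (simp add: H_def)
  qed
  \<comment> \<open>The two lifts were chosen independently; on the convex set of common chords they
    differ by a constant, so \<open>s2\<close> carries over from \<xi> to \<phi>.\<close>
  have s3: "\<phi> p - \<xi> p = \<phi> p' - \<xi> p'" if "p \<in> D1 \<inter> D2" "p' \<in> D1 \<inter> D2" for p p'
  proof (rule exp_constant_imp_constant[of "D1 \<inter> D2" "\<lambda>p. \<phi> p - \<xi> p" 1])
    show "continuous_on (D1 \<inter> D2) (\<lambda>p. \<phi> p - \<xi> p)"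
      by (intro continuous_intros continuous_on_subset[OF \<phi>(1)] continuous_on_subset[OF \<xi>(1)]) auto
    show "exp (\<phi> p - \<xi> p) = 1" if "p \<in> D1 \<inter> D2" for p
      using that \<phi>(2)[of "fst p" "snd p"] \<xi>(2)[of "fst p" "snd p"] cne1[of "fst p" "snd p"]
      by (auto simp: exp_diff)
    show "connected (D1 \<inter> D2)" using conv by (intro convex_connected convex_Int)
  qed (use that in auto)
  define \<epsilon> where "\<epsilon> = min 1 (b - a - 1) / 2"
  have \<epsilon>: "0 < \<epsilon>" "\<epsilon> < 1" "\<epsilon> < b - a - 1" using L by (auto simp: \<epsilon>_def min_def)
  \<comment> \<open>\<open>D3\<close> consists of chords whose unit shift stays in
    \<open>D1\<close>. Sliding inside it to the short chord \<open>(a, a + \<epsilon>)\<close>,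
    which with its shift also lies in \<open>D2\<close>, reduces the claim to
    \<open>s2\<close>.\<close>
  have s4: "\<phi> (a+1, b) - \<phi> (a, b-1) - R (c a, c (b-1)) = K"
  proof -
    define H where "H = (\<lambda>p. \<phi> (fst p+1, snd p+1) - \<phi> (fst p, snd p) - R (c (fst p), c (snd p)))"
    have D31: "D3 \<subseteq> D1" by (auto simp: D3_def D1_def)
    have "H (a, b-1) = H (a, a+\<epsilon>)"
    proof (rule exp_constant_imp_constant[OF convex_connected[OF conv(3)], of H 1])
      show "continuous_on D3 H" unfolding H_def
        by (intro continuous_intros continuous_on_compose2[OF \<phi>(1)] Rcont) (auto simp: D3_def D1_def)
      show "exp (H p) = 1" if p: "p \<in> D3" for p
      proof -
        obtain s t where st: "p = (s, t)" by fastforce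
        have "(s+1, t+1) \<in> D1" "(s, t) \<in> D1" using p by (auto simp: D1_def D3_def st)
        moreover from this have "c s \<noteq> c t" "c (s+1) \<noteq> c (t+1)" using cne1 by auto
        moreover have "0 \<le> s" "0 \<le> t" using p a by (auto simp: D3_def st)
        ultimately show ?thesis by (simp add: H_def st exp_diff \<phi>(2) Rexp)
      qed
    qed (use L \<epsilon> in \<open>auto simp: D3_def\<close>)
    also have "\<dots> = K"
    proof -
      have "(a, a+\<epsilon>) \<in> D1 \<inter> D2" "(a+1, a+\<epsilon>+1) \<in> D1 \<inter> D2"
        using a \<epsilon> by (auto simp: D1_def D2_def)
      from s3[OF this] s2[of a "a+\<epsilon>"] this show ?thesis by (simp add: H_def algebra_simps)
    qed
    finally show ?thesis by (simp add: H_def)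
  qed
  have s5: "\<phi> (b-1, b) - A (c (b-1)) = \<phi> (a, a+1) - A (c a)"
  proof -
    have "\<phi> (b-1, b-1+1) - A (c (b-1)) = \<phi> (a, a+1) - A (c a)"
    proof (rule exp_constant_imp_constant[of "{a..b-1}" "\<lambda>s. \<phi> (s, s+1) - A (c s)" 1])
      show "continuous_on {a..b-1} (\<lambda>s. \<phi> (s, s + 1) - A (c s))"
        by (intro continuous_intros continuous_on_compose2[OF \<phi>(1)] continuous_on_subset[OF Acont])
          (use a L in \<open>auto simp: D1_def\<close>)
      show "exp (\<phi> (s, s + 1) - A (c s)) = 1" if "s \<in> {a..b-1}" for s
      proof -
        have "(s, s+1) \<in> D1" using that L by (auto simp: D1_def)
        then show ?thesis using that a nofix[of "c s"] by (simp add: exp_diff \<phi>(2) A(2) c(2))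
      qed
    qed (use L in auto)
    then show ?thesis by simp
  qed
  \<comment> \<open>Since \<open>c a = c b\<close>, the chords from \<open>c a\<close> to
    \<open>c t\<close> and from \<open>c t\<close> to \<open>c b\<close> are opposite, so their
    logarithms differ by the same logarithm of -1 for all \<open>t\<close>, in particular for
    \<open>a + 1\<close> and \<open>b - 1\<close>.\<close>
  define M where "M = \<phi> (a+1, b) - \<phi> (a, a+1)"
  have s6e: "exp (\<phi> (t, b) - \<phi> (a, t)) = -1" if "t \<in> {a<..<b}" for t
  proof -
    have "(t, b) \<in> D1" "(a, t) \<in> D1" using that by (auto simp: D1_def)
    moreover from this have "c t \<noteq> c b" "c a \<noteq> c t" using cne1 by auto
    ultimately show ?thesis using a(3) by (simp add: exp_diff \<phi>(2) field_simps)
  qed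
  have s6: "\<phi> (b-1, b) - \<phi> (a, b-1) = M" unfolding M_def
  proof (rule exp_constant_imp_constant[of "{a<..<b}" "\<lambda>t. \<phi> (t, b) - \<phi> (a, t)" "-1"])
    show "continuous_on {a<..<b} (\<lambda>t. \<phi> (t, b) - \<phi> (a, t))"
      by (intro continuous_intros continuous_on_compose2[OF \<phi>(1)]) (auto simp: D1_def)
  qed (use L s6e in auto)
  \<comment> \<open>\<open>f\<close> moves the chord between \<open>c (b-1)\<close> and
    \<open>c b = c a\<close> once as the displacement at \<open>b - 1\<close>, onto the displacement
    at \<open>a\<close>, and once as the chord \<open>(a, b-1)\<close>, onto
    \<open>(a+1, b)\<close>. Both logarithms change by the same \<open>R + K\<close>, yet they
    differ by \<open>M\<close> before and by \<open>-M\<close> after.\<close>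
  have "A (c b) = A (c (b-1)) + R (c (b-1), c b) + K"
    using K[of "c (b-1)"] c(2)[of "b-1"] L a by simp
  moreover have "R (c (b-1), c b) = R (c a, c (b-1))"
    using Rs[of "c (b-1)" "c a"] cne1[of a "b-1"] L a by (auto simp: D1_def)
  ultimately have "\<phi> (a, a+1) = \<phi> (b-1, b) + R (c a, c (b-1)) + K"
    using s5 a(3) by (simp add: algebra_simps)
  also have "\<dots> = \<phi> (a, b-1) + R (c a, c (b-1)) + K + M"
    by (simp add: s6[symmetric])
  also have "\<dots> = \<phi> (a+1, b) + M"
    by (simp add: s4[symmetric])
  finally have "2 * M = 0"
    by (simp add: M_def algebra_simps)
  then show False using s6e[of "a+1"] L by (simp add: M_def)
qed

text \<open>The arc runs along two radii of the largest disc around \<open>z\<close> that is disjoint from its image: from a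
  boundary point \<open>w\<close> to \<open>z\<close> and on to the boundary point \<open>f w\<close>. The curve \<open>c\<close> is made of its translates.\<close>

lemma translation_curve:
  fixes f :: "complex \<Rightarrow> complex"
  assumes f: "continuous_on UNIV f" "inj f" and nofix: "\<And>x. f x \<noteq> x"
  obtains c :: "real \<Rightarrow> complex" where "continuous_on {0..} c" "\<And>t. 0 \<le> t \<Longrightarrow> f (c t) = c (t + 1)"
    "\<And>s t. 0 \<le> s \<Longrightarrow> s < t \<Longrightarrow> t \<le> s + 1 \<Longrightarrow> c s \<noteq> c t" "c (1/2) = z"
proof -
  \<comment> \<open>\<open>m x < r\<close> means that \<open>x\<close> and \<open>f x\<close> both
    lie in the open disc of radius \<open>r\<close>, so the minimum of \<open>m\<close> is the
    largest radius whose disc is disjoint from its image. Outside \<open>cball z (m z)\<close> the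
    value exceeds \<open>m z\<close>, so the minimum is global.\<close>
  define m where "m = (\<lambda>x. max (dist z x) (dist z (f x)))"
  have "continuous_on (cball z (m z)) m" unfolding m_def
    by (intro continuous_intros continuous_on_subset[OF f(1)]) auto
  moreover have "z \<in> cball z (m z)" by (auto simp: m_def)
  ultimately obtain w where w: "\<And>x. x \<in> cball z (m z) \<Longrightarrow> m w \<le> m x" "w \<in> cball z (m z)"
    using continuous_attains_inf[of "cball z (m z)" m] by fastforce
  define r where "r = m w"
  have rmin: "r \<le> m x" for x
  proof (cases "x \<in> cball z (m z)")
    case False
    then have "m z \<le> m x" by (auto simp: m_def)
    moreover have "m w \<le> m z" using w(1)[of z] by (auto simp: m_def)
    ultimately show ?thesis by (simp add: r_def)
  qed (use w r_def in auto)
  have free: "f x \<notin> ball z r" if "x \<in> ball z r" for x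
    using rmin[of x] that by (auto simp: m_def)
  have wr: "w \<in> cball z r" "f w \<in> cball z r" by (auto simp: r_def m_def)
  have rpos: "r > 0"
  proof (rule ccontr)
    assume "\<not> r > 0"
    then have "dist z w \<le> 0" "dist z (f w) \<le> 0" using wr unfolding mem_cball by linarith+
    then have "f w = w" by simp
    then show False using nofix by blast
  qed
  have "open (f ` ball z r)"
    by (rule invariance_of_domain) (use f in \<open>auto intro: continuous_on_subset inj_on_subset\<close>)
  then have free2: "f x \<notin> cball z r" if "x \<in> ball z r" for x
  proof -
    have "f ` ball z r \<inter> ball z r = {}" using free by blast
    then have "f ` ball z r \<inter> cball z r = {}"
      using open_Int_closure_eq_empty[OF \<open>open (f ` ball z r)\<close>, of "ball z r"] rpos by simp
    then show ?thesis using that by blast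
  qed
  have w1: "dist z w = r"
    using free2[of w] wr by force
  have w2: "dist z (f w) = r"
  proof (rule ccontr)
    assume "dist z (f w) \<noteq> r"
    then have "f w \<in> ball z r" using wr by auto
    moreover have "open (f -` ball z r)" using f(1) by (simp add: continuous_on_open_vimage)
    ultimately have "(f -` ball z r) \<inter> ball z r \<noteq> {}"
      using open_Int_closure_eq_empty[of "f -` ball z r" "ball z r"] wr rpos by auto
    then show False using free by auto
  qed
  \<comment> \<open>The distance from \<open>z\<close> grows linearly from parameter 1/2 to both
    ends, so two parameters with the same point can only be \<open>s\<close> and
    \<open>1 - s\<close>, on different radii.\<close>
  define \<alpha> where "\<alpha> = (\<lambda>t::real. z + max 0 (1-2*t) *\<^sub>R (w-z) + max 0 (2*t-1) *\<^sub>R (f w - z))"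
  have \<alpha>c: "continuous_on UNIV \<alpha>" unfolding \<alpha>_def by (intro continuous_intros)
  have \<alpha>v: "\<alpha> 0 = w" "\<alpha> 1 = f w" "\<alpha> (1/2) = z" by (auto simp: \<alpha>_def)
  have \<alpha>d: "dist z (\<alpha> t) = \<bar>1-2*t\<bar> * r" for t
    using w1 w2 by (cases "t \<le> 1/2") (auto simp: \<alpha>_def dist_norm norm_minus_commute abs_minus_commute)
  have \<alpha>in: "\<alpha> t \<in> ball z r" if "0 < t" "t < 1" for t
    using that rpos by (simp add: \<alpha>d)
  have \<alpha>cin: "\<alpha> t \<in> cball z r" if "0 \<le> t" "t \<le> 1" for t
    using that rpos by (simp add: \<alpha>d)
  have \<alpha>inj: "\<alpha> s \<noteq> \<alpha> t" if "0 \<le> s" "s < t" "t \<le> 1" for s t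
  proof
    assume e: "\<alpha> s = \<alpha> t"
    then have "abs (1-2 * s) = abs (1-2*t)" using \<alpha>d[of s] \<alpha>d[of t] rpos by simp
    then have t: "t = 1 - s" "s < 1/2" using that by auto
    have "\<alpha> s = z + (1-2 * s) *\<^sub>R (w-z)" "\<alpha> t = z + (1-2 * s) *\<^sub>R (f w - z)"
      using t by (auto simp: \<alpha>_def)
    then have "(1-2 * s) *\<^sub>R (w-z) = (1-2 * s) *\<^sub>R (f w - z)" using e by (metis add_left_cancel)
    then have "w - z = f w - z" using t by (simp del: diff_add_cancel add: scaleR_cancel_left)
    then show False using nofix[of w] by simp
  qed
  \<comment> \<open>The image of the open disc avoids the closed disc, which leaves only
    \<open>f w\<close>, and that is the excluded end \<open>\<alpha> 1\<close>.\<close>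
  have \<alpha>f: "\<alpha> s \<noteq> f (\<alpha> t)" if "0 \<le> s" "s < 1" "0 \<le> t" "t < 1" for s t
  proof (cases "t = 0")
    case True
    then show ?thesis using \<alpha>in[of s] w2 \<alpha>v nofix[of w] that by (cases "s = 0") force+
  next
    case False
    then show ?thesis using free2[OF \<alpha>in[of t]] \<alpha>cin[of s] that by force
  qed
  have finj: "inj (f ^^ n)" for n using f(2) by (rule inj_fn)
  have fcont: "continuous_on UNIV (f ^^ n)" for n
    by (induction n) (auto intro!: continuous_on_compose2[OF f(1)] simp: comp_def)
  define c where "c = (\<lambda>t::real. (f ^^ nat \<lfloor>t\<rfloor>) (\<alpha> (frac t)))"
  have ceq: "c (real n + u) = (f ^^ n) (\<alpha> u)" if "0 \<le> u" "u \<le> 1" for n u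
  proof (cases "u = 1")
    case True
    then have "real n + u = real (Suc n)" by simp
    then show ?thesis using \<alpha>v True unfolding c_def
      by (simp add: frac_def nat_add_distrib funpow_swap1 del: of_nat_Suc)
  next
    case False
    then have "\<lfloor>real n + u\<rfloor> = int n" using that by (simp add: floor_unique)
    then show ?thesis by (simp add: c_def frac_def)
  qed
  have split: "\<exists>n u. t = real n + u \<and> 0 \<le> u \<and> u < 1" if "0 \<le> t" for t
    by (rule exI[of _ "nat \<lfloor>t\<rfloor>"], rule exI[of _ "frac t"]) (use that in \<open>simp add: frac_def, linarith\<close>)
  show thesis
  proof
    have "continuous_on {0..real n} c" for n
    proof (induction n)
      case (Suc n)
      have "continuous_on {real n..real (Suc n)} c"
      proof (rule continuous_on_eq)
        show "continuous_on {real n..real (Suc n)} (\<lambda>t. (f ^^ n) (\<alpha> (t - real n)))"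
          by (intro continuous_on_compose2[OF fcont] continuous_on_compose2[OF \<alpha>c] continuous_intros) auto
        show "(f ^^ n) (\<alpha> (t - real n)) = c t" if "t \<in> {real n..real (Suc n)}" for t
          using ceq[of "t - real n" n] that by simp
      qed
      then have "continuous_on ({0..real n} \<union> {real n..real (Suc n)}) c"
        by (intro continuous_on_closed_Un Suc) auto
      moreover have "{0..real n} \<union> {real n..real (Suc n)} = {0..real (Suc n)}" by auto
      ultimately show ?case by simp
    qed simp
    then show "continuous_on {0..} c"
    proof -
      assume *: "\<And>n. continuous_on {0..real n} c"
      show ?thesis unfolding continuous_on_eq_continuous_within
      proof
        fix t :: real assume t: "t \<in> {0..}"
        obtain n where n: "t < real n" using reals_Archimedean2 by blast
        have "continuous (at t within {0..real n}) c"
          using *[of n] t n by (auto simp: continuous_on_eq_continuous_within)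
        moreover have "at t within {0..} = at t within {0..real n}"
          by (rule at_within_nhd[of _ "{..<real n}"]) (use n in auto)
        ultimately show "continuous (at t within {0..}) c" by (simp add: continuous_within)
      qed
    qed
    show "f (c t) = c (t + 1)" if t: "0 \<le> t" for t
    proof -
      obtain n u where "t = real n + u" "0 \<le> u" "u < 1" using split[OF t] by blast
      moreover from this have "t + 1 = real (Suc n) + u" by simp
      ultimately show ?thesis using ceq[of u n] ceq[of u "Suc n"] by (simp add: add_ac)
    qed
    show "c s \<noteq> c t" if st: "0 \<le> s" "s < t" "t \<le> s + 1" for s t
    proof -
      obtain n u where s: "s = real n + u" "0 \<le> u" "u < 1" using split[OF st(1)] by blast
      show ?thesis
      proof (cases "t \<le> real n + 1")
        case True
        then have "c t = (f ^^ n) (\<alpha> (t - real n))" using ceq[of "t - real n" n] s st by simp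
        moreover have "c s = (f ^^ n) (\<alpha> u)" using ceq[of u n] s by simp
        moreover have "\<alpha> u \<noteq> \<alpha> (t - real n)" using \<alpha>inj[of u "t - real n"] s st True by simp
        ultimately show ?thesis using finj[of n] by (auto dest: injD)
      next
        case False
        then have "c t = (f ^^ Suc n) (\<alpha> (t - real (Suc n)))"
          using ceq[of "t - real (Suc n)" "Suc n"] s st by simp
        then have "c t = (f ^^ n) (f (\<alpha> (t - real (Suc n))))" by (simp add: funpow_swap1)
        moreover have "c s = (f ^^ n) (\<alpha> u)" using ceq[of u n] s by simp
        moreover have "\<alpha> u \<noteq> f (\<alpha> (t - real (Suc n)))"
          using \<alpha>f[of u "t - real (Suc n)"] s st False by simp
        ultimately show ?thesis using finj[of n] by (auto dest: injD)
      qed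
    qed
    show "c (1/2) = z" using ceq[of "1/2" 0] \<alpha>v by simp
  qed
qed

text \<open>A periodic point makes the translation curve return to \<open>z\<close> after
  \<open>n\<close> time units. The self-intersection with the earliest second time closes a loop
  that is simple up to that time, which \<open>no_simple_loop\<close> excludes.\<close>

lemma no_periodic_point:
  assumes R: "rotation_of f R" and nofix: "\<And>x. f x \<noteq> x" and n: "0 < n" "(f ^^ n) z = z"
  shows False
proof -
  have f: "continuous_on UNIV f" using R by (simp add: rotation_of_def)
  obtain c :: "real \<Rightarrow> complex" where c: "continuous_on {0..} c" "\<And>t. 0 \<le> t \<Longrightarrow> f (c t) = c (t + 1)"
    "\<And>s t. 0 \<le> s \<Longrightarrow> s < t \<Longrightarrow> t \<le> s + 1 \<Longrightarrow> c s \<noteq> c t" "c (1/2) = z"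
    using translation_curve[OF f rotation_of_inj[OF R] nofix] by blast
  have ck: "c (1/2 + real k) = (f ^^ k) z" for k
  proof (induction k)
    case (Suc k)
    then show ?case using c(2)[of "1/2 + real k"] by (simp add: add_ac)
  qed (simp add: c(4)[simplified])
  \<comment> \<open>A time gap of at least 1 keeps the set closed and away from the diagonal; by
    \<open>c(3)\<close> shorter gaps never give a self-intersection.\<close>
  define X where "X = {0..1/2 + real n} \<times> {0..1/2 + real n} \<inter> {p. fst p + 1 \<le> snd p}"
  define Y where "Y = {p \<in> X. c (fst p) - c (snd p) = 0}"
  have "closed X" "compact X" unfolding X_def
    by (intro closed_Int closed_Times closed_atLeastAtMost closed_Collect_le
        compact_Int_closed compact_Times compact_Icc continuous_intros)+
  then have "compact Y"  unfolding Y_def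
  proof -
    have "continuous_on X (\<lambda>p. c (fst p) - c (snd p))"
      by (intro continuous_intros continuous_on_compose2[OF c(1)]) (auto simp: X_def)
    from continuous_closed_preimage_constant[OF this \<open>closed X\<close>, of 0] \<open>compact X\<close>
    show "compact {p \<in> X. c (fst p) - c (snd p) = 0}"
      by (metis (no_types, lifting) compact_Int_closed inf.absorb2 mem_Collect_eq subsetI)
  qed
  have "(1/2, 1/2 + real n) \<in> Y" using ck[of n] c(4) n by (auto simp: Y_def X_def)
  then obtain p where p: "p \<in> Y" "\<And>q. q \<in> Y \<Longrightarrow> snd p \<le> snd q"
    using continuous_attains_inf[OF \<open>compact Y\<close> _ continuous_on_snd[OF continuous_on_id]] by blast
  show False
  proof (rule no_simple_loop[OF R nofix c(1-3)])
    show "0 \<le> fst p" "fst p < snd p" "c (fst p) = c (snd p)" using p(1) by (auto simp: Y_def X_def)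
    have ne: "c s \<noteq> c t" if "0 \<le> s" "s < t" "t < snd p" for s t
    proof
      assume e: "c s = c t"
      then have "s + 1 \<le> t" using c(3)[of s t] that by force
      then have "(s, t) \<in> Y" using e that p(1) by (auto simp: Y_def X_def)
      then show False using p(2)[of "(s,t)"] that by simp
    qed
    show "inj_on c {0..<snd p}"
    proof (rule linorder_inj_onI)
      show "c x \<noteq> c y" if "x < y" "x \<in> {0..<snd p}" "y \<in> {0..<snd p}" for x y
        using ne[of x y] that by auto
    qed auto
  qed
qed

section \<open>Closing a bounded orbit by a small perturbation\<close>

text \<open>A closest pair with minimal time gap: the points in between stay strictly further away, which leaves
  room for a perturbation supported away from them.\<close>

lemma bounded_orbit_close_pair:
  fixes f :: "complex \<Rightarrow> complex"
  assumes "bounded (range (\<lambda>n. (f ^^ n) z))" "0 < \<epsilon>"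
  obtains i n where "0 < n" "dist ((f ^^ i) z) ((f ^^ (i + n)) z) < \<epsilon>"
    "\<And>k. 0 < k \<Longrightarrow> k < n \<Longrightarrow> dist ((f ^^ i) z) ((f ^^ (i + n)) z) < dist ((f ^^ (i + k)) z) ((f ^^ (i + n)) z)"
proof -
  define x where "x = (\<lambda>n. (f ^^ n) z)"
  obtain l r where r: "strict_mono r" "(\<lambda>n. x (r n)) \<longlonglongrightarrow> l"
    using bounded_imp_convergent_subsequence[OF assms(1)] by (auto simp: x_def comp_def)
  then have "Cauchy (\<lambda>n. x (r n))" using LIMSEQ_imp_Cauchy by blast
  then obtain M where "\<And>m n. m \<ge> M \<Longrightarrow> n \<ge> M \<Longrightarrow> dist (x (r m)) (x (r n)) < \<epsilon>"
    using assms(2) unfolding Cauchy_def by meson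
  then have "dist (x (r M)) (x (r (Suc M))) < \<epsilon>" by simp
  moreover have "r M < r (Suc M)" using r(1) by (simp add: strict_mono_def)
  ultimately obtain i0 j0 where ij0: "i0 < j0" "dist (x i0) (x j0) < \<epsilon>" by blast
  \<comment> \<open>Bounding the second index by \<open>j0\<close> makes the set of pairs finite and
    keeps one pair closer than \<epsilon>.\<close>
  define S where "S = {p. fst p < snd p \<and> snd p \<le> j0}"
  have "S \<subseteq> {..j0} \<times> {..j0}" by (auto simp: S_def)
  then have S: "finite S" "(i0, j0) \<in> S"
    using finite_subset by (blast, use ij0 in \<open>auto simp: S_def\<close>)
  define D where "D = (\<lambda>p. dist (x (fst p)) (x (snd p)))"
  define d where "d = Min (D ` S)"
  have d: "d \<le> D p" if "p \<in> S" for p using S that by (auto simp: d_def)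
  have "d \<in> D ` S" unfolding d_def using S by (intro Min_in) auto
  then obtain p0 where p0: "p0 \<in> S \<and> D p0 = d" by auto
  obtain p where p: "p \<in> S \<and> D p = d" "\<And>q. q \<in> S \<and> D q = d \<Longrightarrow> snd p - fst p \<le> snd q - fst q"
    using ex_has_least_nat[of "\<lambda>p. p \<in> S \<and> D p = d" p0 "\<lambda>p. snd p - fst p"] p0 by blast
  show thesis
  proof (rule that[of "snd p - fst p" "fst p"])
    have le: "fst p < snd p" using p by (auto simp: S_def)
    then show "0 < snd p - fst p" by simp
    have eq: "dist ((f ^^ fst p) z) ((f ^^ (fst p + (snd p - fst p))) z) = d"
      using p le by (simp add: D_def x_def)
    show "dist ((f ^^ fst p) z) ((f ^^ (fst p + (snd p - fst p))) z) < \<epsilon>"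
      unfolding eq using d[OF S(2)] ij0 by (simp add: D_def)
    fix k assume k: "0 < k" "k < snd p - fst p"
    then have q: "(fst p + k, snd p) \<in> S" using p by (auto simp: S_def)
    with p(2)[of "(fst p + k, snd p)"] k have "D (fst p + k, snd p) \<noteq> d" by auto
    then have "d < D (fst p + k, snd p)" using d[OF q] by simp
    then show "dist ((f ^^ fst p) z) ((f ^^ (fst p + (snd p - fst p))) z)
        < dist ((f ^^ (fst p + k)) z) ((f ^^ (fst p + (snd p - fst p))) z)"
      unfolding eq using le by (simp add: D_def x_def)
  qed
qed

text \<open>The perturbation acts after \<open>f\<close> and multiplies the difference quotient by
  \<open>q\<close>. By the Lipschitz bound \<open>q\<close> lies within distance 1 of 1, where the
  principal logarithm is continuous, and \<open>q\<close> is symmetric.\<close>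

lemma rotation_of_bump:
  fixes b :: "complex \<Rightarrow> real"
  assumes R: "rotation_of f R" and b: "continuous_on UNIV b"
    and lip: "\<And>x y. x \<noteq> y \<Longrightarrow> \<bar>b x - b y\<bar> * norm v < norm (x - y)"
  shows "\<exists>R'. rotation_of (\<lambda>x. f x + of_real (b (f x)) * v) R'"
proof -
  define q where "q = (\<lambda>p. 1 + of_real (b (f (fst p)) - b (f (snd p))) * v / (f (fst p) - f (snd p)))"
  note f = R[unfolded rotation_of_def, THEN conjunct1]
  note Rc = R[unfolded rotation_of_def, THEN conjunct2, THEN conjunct1]
  have Rs: "R (x, y) = R (y, x)" and Re: "f x - f y = exp (R (x, y)) * (x - y)" if "x \<noteq> y" for x y
    using R that unfolding rotation_of_def by blast+
  have inj: "f x \<noteq> f y" if "x \<noteq> y" for x y using rotation_of_inj[OF R] that by (auto dest: injD)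
  have q: "q p \<notin> \<real>\<^sub>\<le>\<^sub>0" if "fst p \<noteq> snd p" for p
  proof -
    have ne: "f (fst p) \<noteq> f (snd p)" using inj that by blast
    have "norm (q p - 1) < 1"
      using lip[OF ne] ne by (simp add: q_def norm_mult norm_divide divide_less_eq flip: of_real_diff)
    then have "Re (q p) > 0" using abs_Re_le_cmod[of "q p - 1"] by auto
    then show ?thesis by (auto simp: complex_nonpos_Reals_iff)
  qed
  have fc: "continuous_on S (\<lambda>p. f (h p))" if "continuous_on S h" for S :: "(complex\<times>complex) set" and h
    by (rule continuous_on_compose2[OF f that]) auto
  have bc: "continuous_on S (\<lambda>p. b (h p))" if "continuous_on S h" for S :: "'z::topological_space set" and h
    by (rule continuous_on_compose2[OF b that]) auto
  have "continuous_on {p. fst p \<noteq> snd p} q" unfolding q_def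
    by (intro continuous_intros fc bc) (use inj in auto)
  then have Lc: "continuous_on {p. fst p \<noteq> snd p} (\<lambda>p. R p + Ln (q p))"
    by (intro continuous_intros Rc continuous_on_compose2[OF continuous_on_Ln]) (use q in auto)
  have qs: "q (x, y) = q (y, x)" if "x \<noteq> y" for x y
    using inj[OF that] inj[OF that[symmetric]] by (simp add: q_def field_simps)
  have qe: "f x + of_real (b (f x)) * v - (f y + of_real (b (f y)) * v) = q (x, y) * (f x - f y)" if "x \<noteq> y" for x y
    using inj[OF that] by (simp add: q_def field_simps)
  have "rotation_of (\<lambda>x. f x + of_real (b (f x)) * v) (\<lambda>p. R p + Ln (q p))"
    unfolding rotation_of_def
  proof (intro conjI allI impI Lc)
    show "continuous_on UNIV (\<lambda>x. f x + of_real (b (f x)) * v)"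
      by (intro continuous_intros f bc)
    fix x y :: complex assume xy: "x \<noteq> y"
    show "R (x, y) + Ln (q (x, y)) = R (y, x) + Ln (q (y, x))" using Rs[OF xy] qs[OF xy] by simp
    have "q (x, y) \<noteq> 0" using q[of "(x, y)"] xy by auto
    then show "f x + of_real (b (f x)) * v - (f y + of_real (b (f y)) * v) = exp (R (x, y) + Ln (q (x, y))) * (x - y)"
      unfolding qe[OF xy] using Re[OF xy] by (simp add: exp_add)
  qed
  then show ?thesis by blast
qed

text \<open>The perturbation pushes \<open>w n\<close> back to \<open>w 0\<close>, and its support
  misses the points in between, so the orbit closes up with period \<open>n\<close>. It is too small
  to cancel the displacement of \<open>f\<close>, so it creates no fixed point.\<close>

theorem bounded_orbit_fixed_point:
  assumes R: "rotation_of f R" and bdd: "bounded (range (\<lambda>n. (f ^^ n) z))"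
  shows "\<exists>x. f x = x"
proof (rule ccontr)
  assume "\<nexists>x. f x = x"
  then have nofix: "f x \<noteq> x" for x by auto
  have f: "continuous_on UNIV f" using R by (simp add: rotation_of_def)
  obtain M where M: "norm ((f ^^ n) z) \<le> M" for n using bdd by (auto simp: bounded_iff)
  have "continuous_on (cball 0 (M+1)) (\<lambda>x. norm (f x - x))"
    by (intro continuous_intros continuous_on_subset[OF f]) auto
  moreover have "M \<ge> 0" using M[of 0] norm_ge_zero order_trans by blast
  ultimately obtain x0 where x0: "\<And>x. x \<in> cball 0 (M+1) \<Longrightarrow> norm (f x0 - x0) \<le> norm (f x - x)"
    using continuous_attains_inf[of "cball 0 (M+1)" "\<lambda>x. norm (f x - x)"] by fastforce
  define m where "m = norm (f x0 - x0)"
  have m: "m > 0" using nofix by (simp add: m_def)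
  \<comment> \<open>The bound 1 keeps the support inside \<open>cball 0 (M+1)\<close>, where the
    displacement is at least \<open>m\<close>; the bound \<open>m/2\<close> keeps the perturbation
    below \<open>m\<close>.\<close>
  define \<rho>0 where "\<rho>0 = min 1 (m/2)"
  have \<rho>0: "\<rho>0 > 0" using m by (simp add: \<rho>0_def)
  obtain i n where n: "0 < n" "dist ((f ^^ i) z) ((f ^^ (i + n)) z) < \<rho>0"
    "\<And>k. 0 < k \<Longrightarrow> k < n \<Longrightarrow> dist ((f ^^ i) z) ((f ^^ (i + n)) z) < dist ((f ^^ (i + k)) z) ((f ^^ (i + n)) z)"
    using bounded_orbit_close_pair[OF bdd \<rho>0] by metis
  define w where "w = (\<lambda>k. (f ^^ (i + k)) z)"
  define \<rho> where "\<rho> = Min (insert \<rho>0 ((\<lambda>k. dist (w k) (w n)) ` {0<..<n}))"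
  define v where "v = w 0 - w n"
  have \<rho>: "norm v < \<rho>" "\<rho> \<le> \<rho>0" "\<And>k. 0 < k \<Longrightarrow> k < n \<Longrightarrow> \<rho> \<le> dist (w k) (w n)"
    unfolding \<rho>_def using n by (auto simp: v_def w_def dist_norm)
  have \<rho>pos: "\<rho> > 0" using \<rho>(1) norm_ge_zero[of v] by linarith
  \<comment> \<open>Slope \<open>1/\<rho>\<close> together with \<open>norm v < \<rho>\<close> gives
    the strict Lipschitz condition of \<open>rotation_of_bump\<close>.\<close>
  define b where "b = (\<lambda>x. max 0 (1 - dist x (w n) / \<rho>))"
  have bc: "continuous_on UNIV b" unfolding b_def by (intro continuous_intros) (use \<rho>pos in auto)
  have blip: "\<bar>b x - b y\<bar> * norm v < norm (x - y)" if "x \<noteq> y" for x y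
  proof -
    have "\<bar>b x - b y\<bar> \<le> \<bar>(1 - dist x (w n) / \<rho>) - (1 - dist y (w n) / \<rho>)\<bar>" unfolding b_def by linarith
    also have "\<dots> = \<bar>dist y (w n) - dist x (w n)\<bar> / \<rho>" using \<rho>pos by (simp add: diff_divide_distrib[symmetric])
    also have "\<dots> \<le> norm (x - y) / \<rho>"
      using \<rho>pos dist_triangle2[of x "w n" y] dist_triangle2[of y "w n" x]
      by (intro divide_right_mono) (auto simp: dist_norm norm_minus_commute dist_commute)
    finally have "\<bar>b x - b y\<bar> * norm v \<le> norm (x - y) / \<rho> * norm v" by (rule mult_right_mono) simp
    also have "\<dots> < norm (x - y) / \<rho> * \<rho>" using \<rho> \<rho>pos that by (intro mult_strict_left_mono) auto
    finally show ?thesis using \<rho>pos by simp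
  qed
  define g where "g = (\<lambda>x. f x + of_real (b (f x)) * v)"
  obtain R' where R': "rotation_of g R'" using rotation_of_bump[OF R bc blip] g_def by auto
  have gnofix: "g x \<noteq> x" for x
  proof
    assume gx: "g x = x"
    \<comment> \<open>With \<open>b = b (f x)\<close>, the point \<open>f x\<close> is at distance
      \<open>(1 - b) \<rho>\<close> from \<open>w n\<close>, and \<open>x\<close> is closer than
      \<open>b \<rho>\<close> to \<open>f x\<close>. Hence \<open>x\<close> itself is within \<rho>
      of \<open>w n\<close>, where the bound \<open>m\<close> applies.\<close>
    have nz: "b (f x) \<noteq> 0" using gx nofix[of x] by (auto simp: g_def)
    then have bpos: "0 < b (f x)" "b (f x) = 1 - dist (f x) (w n) / \<rho>"
      by (simp_all add: b_def max_def less_le split: if_splits)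
    then have d1: "dist (f x) (w n) = (1 - b (f x)) * \<rho>" using \<rho>pos by (simp add: field_simps)
    have e: "dist x (f x) = b (f x) * norm v" using gx bpos by (metis add_diff_cancel_left' dist_norm g_def norm_mult norm_of_real abs_of_pos)
    then have d2: "dist x (f x) < b (f x) * \<rho>" using \<rho> bpos by simp
    have "dist x (w n) \<le> dist x (f x) + dist (f x) (w n)" by (rule dist_triangle)
    then have "dist x (w n) < \<rho>" using d1 d2 by (simp add: algebra_simps)
    moreover have "norm (w n) \<le> M" using M by (simp add: w_def)
    moreover have "\<rho> \<le> 1" "\<rho> \<le> m/2" using \<rho> by (auto simp: \<rho>0_def)
    ultimately have "x \<in> cball 0 (M+1)" using dist_triangle[of 0 x "w n"] by (simp add: dist_commute)
    then have "m \<le> dist x (f x)" using x0[of x] by (simp add: m_def dist_norm norm_minus_commute)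
    also have "\<dots> < b (f x) * \<rho>" by (rule d2)
    also have "\<dots> \<le> 1 * \<rho>" using \<rho>pos by (intro mult_right_mono) (auto simp: b_def)
    finally show False using \<open>\<rho> \<le> m/2\<close> m by simp
  qed
  have fw: "f (w k) = w (Suc k)" for k by (simp add: w_def)
  have gk: "(g ^^ k) (w 0) = w k" if "k < n" for k
    using that
  proof (induction k)
    case (Suc k)
    then have "b (w (Suc k)) = 0" using \<rho>(3)[of "Suc k"] \<rho>pos by (simp add: b_def field_simps)
    then show ?case using Suc fw[of k] by (simp add: g_def)
  qed simp
  obtain k where k: "n = Suc k" using n(1) by (cases n) auto
  then have "(g ^^ n) (w 0) = g (w k)" using gk[of k] by simp
  also have "\<dots> = w 0" using fw[of k] k \<rho>pos by (simp add: g_def b_def v_def)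
  finally show False using no_periodic_point[OF R' gnofix n(1)] by blast
qed

section \<open>Pointwise bounds from integral bounds\<close>

text \<open>The mean of each partial sum over the interval is at most \<open>K\<close>, so each
  compact set \<open>U N\<close> is nonempty; the sets are nested, and a common point serves all
  \<open>N\<close>.\<close>

lemma summable_integrals_bounded_point:
  fixes g :: "nat \<Rightarrow> real \<Rightarrow> real"
  assumes ab: "a < b" and g: "\<And>n. continuous_on {a..b} (g n)" "\<And>n t. t \<in> {a..b} \<Longrightarrow> 0 \<le> g n t"
    and C: "\<And>N. (\<Sum>n<N. integral {a..b} (g n)) \<le> C"
  obtains t K where "t \<in> {a..b}" "\<And>N. (\<Sum>n<N. g n t) \<le> K"
proof -
  define K where "K = C / (b - a)"
  define U where "U = (\<lambda>N. {t \<in> {a..b}. (\<Sum>n<N. g n t) \<le> K})"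
  have Gc: "continuous_on {a..b} (\<lambda>t. \<Sum>n<N. g n t)" for N by (intro continuous_intros g)
  have "closed (U N)" for N unfolding U_def
    using continuous_closed_preimage[OF Gc[of N] closed_atLeastAtMost, of "{..K}"]
    by (simp add: vimage_def Int_def)
  then have "compact (U N)" for N
    using compact_Int_closed[of "{a..b}" "U N"] by (simp add: U_def Int_absorb1 inf.absorb2 subset_iff)
  moreover have "U N \<noteq> {}" for N
  proof
    assume "U N = {}"
    then have *: "K < (\<Sum>n<N. g n t)" if "t \<in> {a..b}" for t using that by (force simp: U_def)
    have "integral {a..b} (\<lambda>t. \<Sum>n<N. g n t) > integral {a..b} (\<lambda>t. K)"
      by (rule integral_less_real) (use * ab Gc in \<open>auto intro: integrable_continuous_real\<close>)
    moreover have "integral {a..b} (\<lambda>t. \<Sum>n<N. g n t) = (\<Sum>n<N. integral {a..b} (g n))"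
      by (rule integral_sum) (auto intro: integrable_continuous_real g)
    ultimately show False using C[of N] ab by (simp add: K_def)
  qed
  moreover have "U n \<subseteq> U m" if "m \<le> n" for m n
  proof -
    have "(\<Sum>k<m. g k t) \<le> (\<Sum>k<n. g k t)" if "t \<in> {a..b}" for t
      by (rule sum_mono2) (use \<open>m \<le> n\<close> g(2) that in auto)
    then show ?thesis by (force simp: U_def)
  qed
  ultimately have "\<Inter>(range U) \<noteq> {}"
    by (intro compact_nest) auto
  then obtain t where "\<And>N. t \<in> U N" by auto
  then show thesis by (intro that[of t K]) (auto simp: U_def)
qed

text \<open>Convergence in mean gives pointwise convergence of a subsequence; one point suffices
  here. Integrals below \<open>(1/2)^n\<close> make the series converge at some
  \<open>t\<close>.\<close>

lemma integral_tendsto_0_subseq: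
  fixes g :: "nat \<Rightarrow> real \<Rightarrow> real"
  assumes ab: "a < b" and g: "\<And>n. continuous_on {a..b} (g n)" "\<And>n t. t \<in> {a..b} \<Longrightarrow> 0 \<le> g n t"
    and lim: "(\<lambda>n. integral {a..b} (g n)) \<longlonglongrightarrow> 0"
  obtains t r where "t \<in> {a..b}" "strict_mono r" "(\<lambda>n. g (r n) t) \<longlonglongrightarrow> 0"
proof -
  have ex: "\<exists>k>m. integral {a..b} (g k) < (1/2)^n" for m n
  proof -
    have "eventually (\<lambda>k. integral {a..b} (g k) < (1/2)^n \<and> k > m) sequentially"
      by (intro eventually_conj order_tendstoD(2)[OF lim] eventually_gt_at_top) simp
    then show ?thesis by (auto dest: eventually_happens)
  qed
  have "\<exists>r. \<forall>n. integral {a..b} (g (r n)) < (1/2)^n \<and> r n < r (Suc n)"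
    by (rule dependent_nat_choice) (use ex in blast)+
  then obtain r where r: "\<And>n. integral {a..b} (g (r n)) < (1/2)^n" "\<And>n. r n < r (Suc n)" by auto
  have "(\<Sum>n<N. integral {a..b} (g (r n))) \<le> 2" for N
  proof -
    have "(\<Sum>n<N. integral {a..b} (g (r n))) \<le> (\<Sum>n<N. (1/2)^n)" by (intro sum_mono less_imp_le r)
    also have "\<dots> \<le> (\<Sum>n. (1/2::real)^n)" by (intro sum_le_suminf summable_geometric) auto
    also have "\<dots> = 2" by (subst suminf_geometric) auto
    finally show ?thesis .
  qed
  then obtain t K where t: "t \<in> {a..b}" "\<And>N. (\<Sum>n<N. g (r n) t) \<le> K"
    using summable_integrals_bounded_point[OF ab, of "\<lambda>n. g (r n)" 2] g by blast
  have "summable (\<lambda>n. g (r n) t)"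
    by (rule summableI_nonneg_bounded[of _ K]) (use t g in auto)
  then show thesis using that[of t r] t r(2) by (simp add: summable_LIMSEQ_zero strict_mono_Suc_iff)
qed

text \<open>The completeness argument for square-integrable functions, carried out at a single
  point.\<close>

lemma integral_Cauchy_subseq:
  fixes w :: "nat \<Rightarrow> real \<Rightarrow> 'h::{real_normed_vector, complete_space}"
  assumes ab: "a < b" and w: "\<And>n. continuous_on {a..b} (w n)"
    and lim: "\<And>e. 0 < e \<Longrightarrow> \<exists>M. \<forall>m\<ge>M. \<forall>n\<ge>M. integral {a..b} (\<lambda>t. (norm (w m t - w n t))\<^sup>2) < e"
  obtains t r where "t \<in> {a..b}" "strict_mono r" "convergent (\<lambda>n. w (r n) t)"
proof -
  define I where "I = (\<lambda>m n. integral {a..b} (\<lambda>t. (norm (w m t - w n t))\<^sup>2))"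
  have "\<exists>r. \<forall>n. (\<forall>i\<ge>r n. \<forall>j\<ge>r n. I i j < (1/8)^n) \<and> r n < r (Suc n)"
  proof (rule dependent_nat_choice)
    show "\<exists>x. \<forall>i\<ge>x. \<forall>j\<ge>x. I i j < (1/8)^0" using lim[of 1] by (simp add: I_def)
    show "\<exists>y. (\<forall>i\<ge>y. \<forall>j\<ge>y. I i j < (1/8)^Suc n) \<and> x < y" for x n
    proof -
      obtain M where "\<forall>i\<ge>M. \<forall>j\<ge>M. I i j < (1/8)^Suc n" using lim[of "(1/8)^Suc n"] unfolding I_def by auto
      then show ?thesis by (intro exI[of _ "max M (Suc x)"]) auto
    qed
  qed
  then obtain r where r: "\<And>n i j. i \<ge> r n \<Longrightarrow> j \<ge> r n \<Longrightarrow> I i j < (1/8)^n" "\<And>n. r n < r (Suc n)" by blast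
  have rI: "I (r (Suc n)) (r n) < (1/8)^n" for n using r(1)[of n "r (Suc n)" "r n"] r(2)[of n] by simp
  \<comment> \<open>The integrals are below \<open>(1/8)^n\<close>, so the weight \<open>4^n\<close>
    leaves the summable \<open>(1/2)^n\<close>; a bound on the weighted squares at \<open>t\<close>
    then makes the increments there of order \<open>(1/2)^n\<close>.\<close>
  define g where "g = (\<lambda>n t. 4^n * (norm (w (r (Suc n)) t - w (r n) t))\<^sup>2)"
  have gi: "integral {a..b} (g n) \<le> (1/2)^n" for n
  proof -
    have "integral {a..b} (g n) = 4^n * I (r (Suc n)) (r n)" unfolding g_def I_def by simp
    also have "\<dots> \<le> 4^n * (1/8)^n" using rI[of n] by simp
    also have "\<dots> = (1/2)^n" by (simp flip: power_mult_distrib)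
    finally show ?thesis .
  qed
  have "(\<Sum>n<N. integral {a..b} (g n)) \<le> 2" for N
  proof -
    have "(\<Sum>n<N. integral {a..b} (g n)) \<le> (\<Sum>n<N. (1/2)^n)" by (intro sum_mono gi)
    also have "\<dots> \<le> (\<Sum>n. (1/2::real)^n)" by (intro sum_le_suminf summable_geometric) auto
    also have "\<dots> = 2" by (subst suminf_geometric) auto
    finally show ?thesis .
  qed
  moreover have "continuous_on {a..b} (g n)" for n unfolding g_def by (intro continuous_intros w)
  moreover have g0: "0 \<le> g n t" for n t by (simp add: g_def)
  ultimately obtain t K where t: "t \<in> {a..b}" "\<And>N. (\<Sum>n<N. g n t) \<le> K"
    using summable_integrals_bounded_point[OF ab, of g 2] g0 by blast
  have gK: "g n t \<le> K" for n
  proof -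
    have "g n t \<le> (\<Sum>k<Suc n. g k t)" by (rule member_le_sum) (auto simp: g_def)
    then show ?thesis using t(2)[of "Suc n"] by simp
  qed
  have nb: "norm (w (r (Suc n)) t - w (r n) t) \<le> sqrt K * (1/2)^n" for n
  proof -
    have "(4::real)^n = (2^n)\<^sup>2" by (metis num_double numeral_times_numeral power2_eq_square power_mult_distrib)
    then have "(2^n * norm (w (r (Suc n)) t - w (r n) t))\<^sup>2 \<le> K"
      using gK[of n] by (simp add: g_def power_mult_distrib)
    then have "2^n * norm (w (r (Suc n)) t - w (r n) t) \<le> sqrt K" by (rule real_le_rsqrt)
    then show ?thesis by (simp add: field_simps power_one_over)
  qed
  have "summable (\<lambda>n. norm (w (r (Suc n)) t - w (r n) t))"
    by (rule summable_comparison_test'[of "\<lambda>n. sqrt K * (1/2)^n" 0]) (use nb in \<open>auto intro!: summable_mult summable_geometric\<close>)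
  define S where "S = (\<lambda>N. \<Sum>n<N. norm (w (r (Suc n)) t - w (r n) t))"
  have S: "norm (w (r m) t - w (r n) t) \<le> S m - S n" if "n \<le> m" for m n
    using that
  proof (induction m rule: dec_induct)
    case (step m)
    have "norm (w (r (Suc m)) t - w (r n) t) \<le> norm (w (r (Suc m)) t - w (r m) t) + norm (w (r m) t - w (r n) t)"
      using norm_triangle_ineq[of "w (r (Suc m)) t - w (r m) t" "w (r m) t - w (r n) t"] by simp
    then show ?case using step by (simp add: S_def)
  qed simp
  have "Cauchy S" unfolding S_def
    using \<open>summable _\<close> by (simp add: summable_iff_convergent convergent_Cauchy)
  have "Cauchy (\<lambda>n. w (r n) t)"
  proof (rule CauchyI')
    fix e :: real assume "0 < e"
    then obtain M where M: "\<And>m n. m \<ge> M \<Longrightarrow> n \<ge> M \<Longrightarrow> dist (S m) (S n) < e"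
      using \<open>Cauchy S\<close> unfolding Cauchy_def by meson
    show "\<exists>M. \<forall>m\<ge>M. \<forall>n>m. dist (w (r m) t) (w (r n) t) < e"
    proof (intro exI allI impI)
      fix m n assume "m \<ge> M" "n > m"
      then show "dist (w (r m) t) (w (r n) t) < e"
        unfolding dist_norm using S[of m n] M[of n m] by (auto simp: dist_real_def norm_minus_commute)
    qed
  qed
  then show thesis using that[of t r] t(1) r(2) by (simp add: Cauchy_convergent_iff strict_mono_Suc_iff)
qed

text \<open>If \<open>g n t\<close> tended to infinity at every \<open>t\<close>, the truncations
  \<open>h n\<close> would tend to 0 boundedly, hence in mean; but the bound on the integrals of
  \<open>g n\<close> keeps those of \<open>h n\<close> above \<open>(b - a) - C / K\<close>, which
  is positive by the choice of \<open>K\<close>.\<close>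

lemma bounded_integrals_bounded_subseq:
  fixes g :: "nat \<Rightarrow> real \<Rightarrow> real"
  assumes ab: "a < b" and g: "\<And>n. continuous_on {a..b} (g n)" "\<And>n t. t \<in> {a..b} \<Longrightarrow> 0 \<le> g n t"
    and C: "\<And>n. integral {a..b} (g n) \<le> C"
  obtains t r B where "t \<in> {a..b}" "strict_mono r" "\<And>n::nat. g (r n) t \<le> B"
proof -
  have C0: "0 \<le> C" using C[of 0] integral_nonneg[of "g 0" "{a..b}"] g integrable_continuous_real[OF g(1)] by force
  have "\<exists>t\<in>{a..b}. \<not> filterlim (\<lambda>n. g n t) at_top sequentially"
  proof (rule ccontr)
    assume "\<not> ?thesis"
    then have inf: "filterlim (\<lambda>n. g n t) at_top sequentially" if "t \<in> {a..b}" for t using that by auto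
    define K where "K = (C + 1) / (b - a)"
    have K: "K > 0" using C0 ab by (simp add: K_def)
    define h where "h = (\<lambda>n t. max 0 (1 - g n t / K))"
    have hc: "continuous_on {a..b} (h n)" for n unfolding h_def by (intro continuous_intros g) (use K in auto)
    have "(\<lambda>n. integral {a..b} (h n)) \<longlonglongrightarrow> integral {a..b} (\<lambda>t. 0)"
    proof (rule dominated_convergence(2))
      show "h n integrable_on {a..b}" for n using hc by (rule integrable_continuous_real)
      show "(\<lambda>t. 1) integrable_on {a..b}" by (rule integrable_const_ivl)
      show "norm (h n t) \<le> 1" if "t \<in> {a..b}" for n t
        using g(2)[OF that, of n] K by (auto simp: h_def)
      show "(\<lambda>n. h n t) \<longlonglongrightarrow> 0" if t: "t \<in> {a..b}" for t
      proof (rule tendsto_eventually)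
        show "\<forall>\<^sub>F n in sequentially. h n t = 0"
          using filterlim_at_top_ge[THEN iffD1, OF inf[OF t], rule_format, of K, OF order_refl]
          by eventually_elim (use K in \<open>simp add: h_def\<close>)
      qed
    qed
    then have "(\<lambda>n. integral {a..b} (h n)) \<longlonglongrightarrow> 0" by simp
    moreover have "(b - a) - C / K \<le> integral {a..b} (h n)" for n
    proof -
      have "(b - a) - C / K \<le> (b - a) - integral {a..b} (g n) / K"
        using C[of n] K by (simp add: divide_right_mono)
      also have "\<dots> = integral {a..b} (\<lambda>t. 1 - g n t / K)"
        using ab integrable_continuous_real[OF g(1)[of n]]
        by (subst integral_diff) (auto intro: integrable_on_divide simp: integral_divide)
      also have "\<dots> \<le> integral {a..b} (h n)"
        by (rule integral_le) (use K in \<open>auto intro!: integrable_continuous_real hc continuous_intros g simp: h_def\<close>)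
      finally show ?thesis .
    qed
    ultimately have "(b - a) - C / K \<le> 0" by (intro LIMSEQ_le_const) auto
    moreover have "C / K < b - a" using C0 ab by (simp add: K_def field_simps)
    ultimately show False by simp
  qed
  then obtain t where t: "t \<in> {a..b}" "\<not> filterlim (\<lambda>n. g n t) at_top sequentially" by blast
  then obtain B where "\<exists>\<^sub>F n in sequentially. \<not> B \<le> g n t"
    by (auto simp: filterlim_at_top frequently_def)
  then have inf: "infinite {n. \<not> B \<le> g n t}" by (simp add: frequently_cofinite cofinite_eq_sequentially[symmetric])
  obtain r :: "nat \<Rightarrow> nat" where r: "strict_mono r" "\<And>n. r n \<in> {n. \<not> B \<le> g n t}"
    using infinite_enumerate[OF inf] by auto
  show thesis by (rule that[OF t(1) r(1), of B]) (use r(2) in \<open>auto simp: not_le intro: less_imp_le\<close>)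
qed

section \<open>Squeezed semiflows\<close>

text \<open>The range is open by invariance of domain, and closed because the lower bound pulls
  Cauchy sequences back to Cauchy sequences.\<close>

lemma expanding_plane_map_surj:
  fixes g :: "complex \<Rightarrow> complex"
  assumes g: "continuous_on UNIV g" and a: "0 < a" "\<And>x y. a * norm (x - y) \<le> norm (g x - g y)"
  shows "surj g"
proof -
  have inj: "inj g"
  proof (rule injI)
    fix x y assume "g x = g y"
    then show "x = y" using a(2)[of x y] a(1) by (simp add: mult_le_0_iff)
  qed
  have "open (range g)" using invariance_of_domain[OF g open_UNIV inj] .
  moreover have "closed (range g)" unfolding closed_sequential_limits
  proof (intro allI impI, elim conjE)
    fix s l assume s: "\<forall>n. s n \<in> range g" "s \<longlonglongrightarrow> l"
    then have "\<forall>n. \<exists>y. s n = g y" by auto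
    from choice[OF this] obtain x where x: "\<And>n. s n = g (x n)" by blast
    have "Cauchy x" unfolding Cauchy_def
    proof (intro allI impI)
      fix e :: real assume "0 < e"
      then have "0 < a * e" using a by simp
      then obtain M where M: "\<And>m n. m \<ge> M \<Longrightarrow> n \<ge> M \<Longrightarrow> dist (s m) (s n) < a * e"
        using LIMSEQ_imp_Cauchy[OF s(2)] unfolding Cauchy_def by meson
      have "dist (x m) (x n) < e" if "m \<ge> M" "n \<ge> M" for m n
      proof -
        have "a * dist (x m) (x n) < a * e"
          using M[OF that] a(2)[of "x m" "x n"] by (simp add: x dist_norm)
        then show ?thesis using a(1) by simp
      qed
      then show "\<exists>M. \<forall>m\<ge>M. \<forall>n\<ge>M. dist (x m) (x n) < e" by blast
    qed
    then obtain y where "x \<longlonglongrightarrow> y" using Cauchy_convergent_iff convergent_def by metis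
    then have "s \<longlonglongrightarrow> g y" unfolding x
      using g by (auto simp: continuous_on_eq_continuous_at intro: isCont_tendsto_compose)
    then show "l \<in> range g" using s(2) LIMSEQ_unique by blast
  qed
  ultimately show ?thesis using clopen[of "range g"] by auto
qed

lemma continuous_on_UNIV_subseqI:
  fixes f :: "'a::metric_space \<Rightarrow> 'b::metric_space"
  assumes "\<And>x l. x \<longlonglongrightarrow> l \<Longrightarrow> \<exists>r::nat\<Rightarrow>nat. strict_mono r \<and> (\<lambda>n. f (x (r n))) \<longlonglongrightarrow> f l"
  shows "continuous_on UNIV f"
proof (rule ccontr)
  assume "\<not> continuous_on UNIV f"
  then obtain l e where e: "0 < e" "\<And>d. d > 0 \<Longrightarrow> \<exists>y. dist y l < d \<and> \<not> dist (f y) (f l) < e"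
    unfolding continuous_on_iff by (metis dist_commute)
  have "\<exists>y. dist y l < 1 / real (Suc n) \<and> \<not> dist (f y) (f l) < e" for n by (rule e(2)) simp
  then obtain x where x: "\<And>n. dist (x n) l < 1 / real (Suc n)" "\<And>n. \<not> dist (f (x n)) (f l) < e" by metis
  have "(\<lambda>n. dist (x n) l) \<longlonglongrightarrow> 0"
    by (rule tendsto_sandwich[OF _ _ tendsto_const LIMSEQ_Suc[OF lim_1_over_n]])
       (use x(1) in \<open>auto intro!: always_eventually less_imp_le\<close>)
  then have "x \<longlonglongrightarrow> l" by (rule tendsto_dist_iff[THEN iffD2])
  from assms[OF this] obtain r :: "nat \<Rightarrow> nat" where "(\<lambda>n. f (x (r n))) \<longlonglongrightarrow> f l" by auto
  then have "\<forall>\<^sub>F n in sequentially. dist (f (x (r n))) (f l) < e" using e(1) by (rule tendstoD)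
  then show False using x(2) by (auto dest: eventually_happens)
qed

lemma norm_sum_sq: "(norm (a + b))\<^sup>2 \<le> 2 * (norm a)\<^sup>2 + 2 * (norm b)\<^sup>2" for a b :: "'a::real_normed_vector"
proof -
  have "(norm (a + b))\<^sup>2 \<le> (norm a + norm b)\<^sup>2" by (simp add: norm_triangle_ineq power_mono)
  also have "\<dots> \<le> 2 * (norm a)\<^sup>2 + 2 * (norm b)\<^sup>2" using sum_squares_bound[of "norm a" "norm b"]
    by (simp add: power2_sum)
  finally show ?thesis .
qed

text \<open>\<open>S t\<close> stands for \<open>\<psi>\<^sup>t(q, \<cdot>)\<close> at one fixed phase \<open>q\<close>; of the cocycle property at other phases only
  \<open>S_factor\<close> is kept. \<open>pr\<close> is the orthogonal projection to \<open>H\<^sup>-\<close> in an orthonormal basis, \<open>J\<close> its right inverse.\<close>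

locale squeezed_semiflow =
  fixes S :: "real \<Rightarrow> 'h \<Rightarrow> 'h::{real_inner, complete_space}"
    and P :: "'h \<Rightarrow> 'h" and pr :: "'h \<Rightarrow> complex" and J :: "complex \<Rightarrow> 'h"
    and \<sigma> \<delta> \<nu> Cp c :: real
  assumes pos: "0 < \<sigma>" "0 < \<delta>" "0 < \<nu>" "0 < Cp" "0 < c"
    and S_0: "S 0 u = u"
    and S_per: "0 \<le> t \<Longrightarrow> S (t + \<sigma>) u = S t (S \<sigma> u)"
    and S_cont: "continuous_on ({0..} \<times> UNIV) (\<lambda>(t, u). S t u)"
    and S_factor: "0 \<le> s \<Longrightarrow> s \<le> t \<Longrightarrow> \<exists>h. continuous_on UNIV h \<and> (\<forall>u. S t u = h (S s u))"
    and squeeze: "0 \<le> l \<Longrightarrow> l \<le> r \<Longrightarrow>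
        exp (2 * \<nu> * r) * quad_form P (S r u - S r v) - exp (2 * \<nu> * l) * quad_form P (S l u - S l v)
        \<le> - \<delta> * integral {l..r} (\<lambda>s. exp (2 * \<nu> * s) * (norm (S s u - S s v))\<^sup>2)"
    and P: "bounded_linear P" and pr: "bounded_linear pr" and J: "bounded_linear J"
    and pr_J: "pr (J z) = z"
    and form_lower: "- Cp * (norm (pr u))\<^sup>2 \<le> quad_form P u"
    and form_upper: "quad_form P u \<le> Cp * (norm u)\<^sup>2"
    and form_J: "quad_form P (J z) \<le> - c * (norm z)\<^sup>2"
    and compactness: "(\<forall>y. bounded (range y) \<longrightarrow> (\<exists>r. strict_mono (r::nat\<Rightarrow>nat) \<and> convergent (\<lambda>n. P (y (r n))))) \<or>
       (\<exists>\<tau>>0. \<forall>s\<ge>0. \<forall>y. bounded (range (\<lambda>n. S s (y n))) \<longrightarrow>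
           (\<exists>r. strict_mono (r::nat\<Rightarrow>nat) \<and> convergent (\<lambda>n. S (s + \<tau>) (y (r n)))))"
begin

abbreviation "V \<equiv> quad_form P"

definition "T = S \<sigma>"
text \<open>These integrals replace distance and norm: squeezing controls only time integrals of
  differences, and \<open>V\<close> is bounded below only through the projection.\<close>

definition "D u v = integral {0..\<sigma>} (\<lambda>t. (norm (S t u - S t v))\<^sup>2)"
definition "W u = integral {0..\<sigma>} (\<lambda>t. (norm (S t u))\<^sup>2)"

section \<open>Iteration, decay of the form and mean square estimates\<close>

lemma S_cont_compose:
  "continuous_on A f \<Longrightarrow> continuous_on A g \<Longrightarrow> (\<And>x. x \<in> A \<Longrightarrow> 0 \<le> f x) \<Longrightarrow> continuous_on A (\<lambda>x. S (f x) (g x))"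
  using continuous_on_compose2[OF S_cont, of A "\<lambda>x. (f x, g x)"] by (auto intro: continuous_on_Pair)

lemma S_cont_u: "0 \<le> t \<Longrightarrow> continuous_on UNIV (S t)"
  using S_cont_compose[of UNIV "\<lambda>_. t" "\<lambda>u. u"] by auto

lemma S_cont_t: "A \<subseteq> {0..} \<Longrightarrow> continuous_on A (\<lambda>t. S t u)"
  by (rule S_cont_compose) (auto intro: continuous_on_id)

lemma S_tendsto: "0 \<le> t \<Longrightarrow> y \<longlonglongrightarrow> l \<Longrightarrow> (\<lambda>n. S t (y n)) \<longlonglongrightarrow> S t l"
  using S_cont_u[of t] by (auto simp: continuous_on_eq_continuous_at intro: isCont_tendsto_compose)

lemma T_tendsto: "y \<longlonglongrightarrow> l \<Longrightarrow> (\<lambda>n. T (y n)) \<longlonglongrightarrow> T l"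
  unfolding T_def using S_tendsto pos by simp

lemma S_funpow: "0 \<le> t \<Longrightarrow> S (t + real k * \<sigma>) u = S t ((T ^^ k) u)"
proof (induction k arbitrary: u)
  case (Suc k)
  have "S (t + real (Suc k) * \<sigma>) u = S ((t + real k * \<sigma>) + \<sigma>) u" by (simp add: algebra_simps)
  also have "\<dots> = S (t + real k * \<sigma>) (T u)"
    using Suc.prems pos S_per[of "t + real k * \<sigma>" u] by (simp add: T_def)
  finally show ?case using Suc by (simp add: funpow_swap1)
qed simp

lemma S_period: "S (real k * \<sigma>) u = (T ^^ k) u"
  using S_funpow[of 0 k u] S_0 by simp

lemma int_diff: "0 \<le> l \<Longrightarrow> (\<lambda>t. (norm (S t u - S t v))\<^sup>2) integrable_on {l..r}"
  by (intro integrable_continuous_real continuous_intros S_cont_t) auto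

lemma squeeze_weak:
  assumes "0 \<le> l" "l \<le> r"
  shows "exp (2 * \<nu> * r) * V (S r u - S r v) + \<delta> * exp (2 * \<nu> * l) * integral {l..r} (\<lambda>s. (norm (S s u - S s v))\<^sup>2)
    \<le> exp (2 * \<nu> * l) * V (S l u - S l v)"
proof -
  have "exp (2 * \<nu> * l) * integral {l..r} (\<lambda>s. (norm (S s u - S s v))\<^sup>2)
     = integral {l..r} (\<lambda>s. exp (2 * \<nu> * l) * (norm (S s u - S s v))\<^sup>2)" by simp
  also have "\<dots> \<le> integral {l..r} (\<lambda>s. exp (2 * \<nu> * s) * (norm (S s u - S s v))\<^sup>2)"
    by (rule integral_le)
       (use assms pos in \<open>auto intro!: integrable_continuous_real continuous_intros S_cont_t mult_right_mono\<close>)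
  finally have "\<delta> * (exp (2 * \<nu> * l) * integral {l..r} (\<lambda>s. (norm (S s u - S s v))\<^sup>2))
     \<le> \<delta> * integral {l..r} (\<lambda>s. exp (2 * \<nu> * s) * (norm (S s u - S s v))\<^sup>2)"
    using pos by (intro mult_left_mono) auto
  then show ?thesis using squeeze[OF assms, of u v] by (simp add: algebra_simps)
qed

lemma form_antimono:
  assumes "0 \<le> l" "l \<le> r"
  shows "exp (2 * \<nu> * r) * V (S r u - S r v) \<le> exp (2 * \<nu> * l) * V (S l u - S l v)"
proof -
  have "0 \<le> integral {l..r} (\<lambda>s. (norm (S s u - S s v))\<^sup>2)"
    by (rule integral_nonneg[OF int_diff]) (use assms in auto)
  then have "0 \<le> \<delta> * exp (2 * \<nu> * l) * integral {l..r} (\<lambda>s. (norm (S s u - S s v))\<^sup>2)"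
    using pos by simp
  then show ?thesis using squeeze_weak[OF assms, of u v] by linarith
qed

text \<open>The difference is nonzero near time 0, so its integral is positive and the weighted form
  drops strictly. With \<open>form_neg_pr\<close> this keeps the projections of two such orbits
  apart at all times, which is the injectivity along the isotopy.\<close>

lemma form_neg:
  assumes "V (u - v) \<le> 0" "u \<noteq> v" "0 < t"
  shows "V (S t u - S t v) < 0"
proof -
  let ?I = "integral {0..t} (\<lambda>s. (norm (S s u - S s v))\<^sup>2)"
  have "?I \<ge> 0" by (rule integral_nonneg[OF int_diff]) auto
  moreover have "?I \<noteq> 0"
  proof
    assume "?I = 0"
    moreover have "continuous_on {0..t} (\<lambda>s. (norm (S s u - S s v))\<^sup>2)"
      by (intro continuous_intros S_cont_t) auto
    ultimately have "\<forall>s\<in>{0..t}. (norm (S s u - S s v))\<^sup>2 = 0"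
      using integral_eq_0_iff[of 0 t "\<lambda>s. (norm (S s u - S s v))\<^sup>2"] assms by auto
    from bspec[OF this, of 0] show False using assms S_0 by simp
  qed
  ultimately have "0 < \<delta> * ?I" using pos by simp
  then have "exp (2 * \<nu> * t) * V (S t u - S t v) < 0"
    using squeeze_weak[of 0 t u v] assms S_0 by simp
  then show ?thesis by (simp add: mult_less_0_iff)
qed

lemma form_neg_pr: "V w < 0 \<Longrightarrow> pr w \<noteq> 0"
  using form_lower[of w] by auto

lemma pr_diff: "pr (u - v) = pr u - pr v"
  using pr by (simp add: bounded_linear.linear linear_diff)

lemma W_nonneg: "0 \<le> W u" and D_nonneg: "0 \<le> D u v"
proof -
  show "0 \<le> D u v" unfolding D_def by (rule integral_nonneg[OF int_diff]) auto
  show "0 \<le> W u" unfolding W_def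
    by (rule integral_nonneg) (auto intro!: integrable_continuous_real continuous_intros S_cont_t)
qed

lemma W_int: "(\<lambda>t. (norm (S t u))\<^sup>2) integrable_on {0..\<sigma>}"
  by (intro integrable_continuous_real continuous_intros S_cont_t) auto

lemma D_le: "D u v \<le> 2 * W u + 2 * W v"
proof -
  have "D u v \<le> integral {0..\<sigma>} (\<lambda>t. 2 * (norm (S t u))\<^sup>2 + 2 * (norm (S t v))\<^sup>2)"
    unfolding D_def
    by (intro integral_le int_diff integrable_add integrable_on_mult_right W_int)
       (use norm_sum_sq[of "S t u" "- S t v" for t] in auto)
  also have "\<dots> = 2 * W u + 2 * W v" unfolding W_def
    by (subst integral_add) (auto intro: integrable_on_mult_right W_int)
  finally show ?thesis .
qed

lemma W_le: "W u \<le> 2 * D u v + 2 * W v"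
proof -
  have "W u \<le> integral {0..\<sigma>} (\<lambda>t. 2 * (norm (S t u - S t v))\<^sup>2 + 2 * (norm (S t v))\<^sup>2)"
    unfolding W_def
    by (intro integral_le int_diff integrable_add integrable_on_mult_right W_int)
       (use norm_sum_sq[of "S t u - S t v" "S t v" for t] in auto)
  also have "\<dots> = 2 * D u v + 2 * W v" unfolding W_def D_def
    by (subst integral_add) (auto intro: integrable_on_mult_right W_int int_diff)
  finally show ?thesis .
qed

lemma W_cont: "continuous_on UNIV W"
proof -
  have "continuous_on UNIV (\<lambda>u. integral (cbox 0 \<sigma>) (\<lambda>t. (norm (S t u))\<^sup>2))"
  proof (rule integral_continuous_on_param)
    show "continuous_on (UNIV \<times> cbox 0 \<sigma>) (\<lambda>(u, t). (norm (S t u))\<^sup>2)"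
      unfolding split_beta by (intro continuous_intros S_cont_compose) auto
  qed
  then show ?thesis unfolding W_def by simp
qed

lemma W_tendsto: "y \<longlonglongrightarrow> l \<Longrightarrow> (\<lambda>n. W (y n)) \<longlonglongrightarrow> W l"
  using W_cont by (auto simp: continuous_on_eq_continuous_at intro: isCont_tendsto_compose)

text \<open>At some time of the period the squared difference is at most its mean
  \<open>D u v / \<sigma>\<close>; the form is bounded there, and the weighted form only decreases
  until the end of the period.\<close>

lemma form_T_le_D: "V (T u - T v) \<le> Cp / \<sigma> * D u v"
proof -
  obtain t where t: "t \<in> {0..\<sigma>}" "(norm (S t u - S t v))\<^sup>2 \<le> D u v / \<sigma>"
  proof -
    have "\<exists>t\<in>{0..\<sigma>}. (norm (S t u - S t v))\<^sup>2 \<le> D u v / \<sigma>"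
    proof (rule ccontr)
      assume "\<not> ?thesis"
      then have *: "D u v / \<sigma> < (norm (S t u - S t v))\<^sup>2" if "t \<in> {0..\<sigma>}" for t using that by force
      have "integral {0..\<sigma>} (\<lambda>t. D u v / \<sigma>) < integral {0..\<sigma>} (\<lambda>t. (norm (S t u - S t v))\<^sup>2)"
        by (intro integral_less_real) (use pos * in \<open>auto intro!: continuous_intros S_cont_t integrable_continuous_real\<close>)
      then show False using pos by (simp add: D_def)
    qed
    then show ?thesis using that by blast
  qed
  have "exp (2 * \<nu> * \<sigma>) * V (T u - T v) \<le> exp (2 * \<nu> * t) * V (S t u - S t v)"
    using form_antimono[of t \<sigma> u v] t by (simp add: T_def)
  also have "\<dots> \<le> exp (2 * \<nu> * t) * (Cp * (D u v / \<sigma>))"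
    using order_trans[OF form_upper[of "S t u - S t v"] mult_left_mono[OF t(2), of Cp]] pos
    by (intro mult_left_mono) auto
  also have "\<dots> \<le> exp (2 * \<nu> * \<sigma>) * (Cp * (D u v / \<sigma>))"
    using t pos D_nonneg by (intro mult_right_mono) auto
  finally have "V (T u - T v) \<le> Cp * (D u v / \<sigma>)" by (simp only: mult_le_cancel_left_pos exp_gt_zero)
  then show ?thesis by simp
qed

text \<open>\<open>z (Suc k)\<close> starts the period that ends at time
  \<open>- k \<sigma>\<close>, hence the exponent \<open>k\<close>. At this rate the form of the
  difference of two backward orbits, weighted by the squeezing exponential, stays bounded
  above.\<close>

definition backward :: "'h \<Rightarrow> real \<Rightarrow> (nat \<Rightarrow> 'h) \<Rightarrow> bool" where
  "backward u C z \<longleftrightarrow> z 0 = u \<and> (\<forall>k. T (z (Suc k)) = z k \<and> W (z (Suc k)) \<le> C * exp (2 * \<nu> * \<sigma> * real k))"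

definition "amenable u \<longleftrightarrow> (\<exists>C z. backward u C z)"

text \<open>\<open>F k\<close> grows at least geometrically once it is positive, but it is bounded by the mean square bound
  on the two backward orbits; hence it is never positive.\<close>

lemma backward_separation:
  assumes z: "backward u C z" and z': "backward u' C' z'"
  shows "\<delta> * exp (- 2 * \<nu> * \<sigma>) * D (z 1) (z' 1) \<le> - V (u - u')"
proof -
  \<comment> \<open>\<open>F k\<close> is the weighted form at time \<open>- k \<sigma>\<close>, and
    \<open>G k\<close> the weighted mean square over the period leading up to it.\<close>
  define F where "F = (\<lambda>k. exp (- 2 * \<nu> * \<sigma> * real k) * V (z k - z' k))"
  define G where "G = (\<lambda>k. exp (- 2 * \<nu> * \<sigma> * real (Suc k)) * D (z (Suc k)) (z' (Suc k)))"
  define K where "K = Cp / \<sigma> * exp (2 * \<nu> * \<sigma>)"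
  have K: "K > 0" using pos by (simp add: K_def)
  have zT: "T (z (Suc k)) = z k" "T (z' (Suc k)) = z' k"
    and zW: "W (z (Suc k)) \<le> C * exp (2 * \<nu> * \<sigma> * real k)" "W (z' (Suc k)) \<le> C' * exp (2 * \<nu> * \<sigma> * real k)" for k
    using z z' by (auto simp: backward_def)
  have F: "F k + \<delta> * G k \<le> F (Suc k)" for k
  proof -
    have "exp (2 * \<nu> * \<sigma>) * V (z k - z' k) + \<delta> * D (z (Suc k)) (z' (Suc k)) \<le> V (z (Suc k) - z' (Suc k))"
      using squeeze_weak[of 0 \<sigma> "z (Suc k)" "z' (Suc k)"] pos zT[of k] S_0 by (simp add: T_def D_def)
    moreover define e1 where "e1 = exp (- 2 * \<nu> * \<sigma> * real (Suc k))"
    ultimately have "e1 * (exp (2 * \<nu> * \<sigma>) * V (z k - z' k) + \<delta> * D (z (Suc k)) (z' (Suc k))) \<le> e1 * V (z (Suc k) - z' (Suc k))"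
      by (intro mult_left_mono) auto
    moreover have "exp (- 2 * \<nu> * \<sigma> * real k) = e1 * exp (2 * \<nu> * \<sigma>)"
      by (simp add: e1_def exp_add[symmetric] algebra_simps)
    then have "F k = e1 * (exp (2 * \<nu> * \<sigma>) * V (z k - z' k))" by (simp add: F_def)
    moreover have "G k = e1 * D (z (Suc k)) (z' (Suc k))" "F (Suc k) = e1 * V (z (Suc k) - z' (Suc k))"
      by (simp_all only: G_def F_def e1_def)
    ultimately show ?thesis by (simp add: algebra_simps)
  qed
  have FG: "F k \<le> K * G k" for k
  proof -
    have "V (z k - z' k) \<le> Cp / \<sigma> * D (z (Suc k)) (z' (Suc k))"
      using form_T_le_D[of "z (Suc k)" "z' (Suc k)"] zT[of k] by simp
    then have "F k \<le> exp (- 2 * \<nu> * \<sigma> * real k) * (Cp / \<sigma> * D (z (Suc k)) (z' (Suc k)))"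
      unfolding F_def by (intro mult_left_mono) auto
    also have "exp (- 2 * \<nu> * \<sigma> * real k) = exp (2 * \<nu> * \<sigma>) * exp (- 2 * \<nu> * \<sigma> * real (Suc k))"
      by (simp add: exp_add[symmetric] algebra_simps)
    finally show ?thesis unfolding K_def G_def by (simp add: mult_ac)
  qed
  have Gb: "G k \<le> 2 * (\<bar>C\<bar> + \<bar>C'\<bar>)" for k
  proof -
    let ?e = "exp (2 * \<nu> * \<sigma> * real k)"
    have "D (z (Suc k)) (z' (Suc k)) \<le> 2 * (C * ?e) + 2 * (C' * ?e)"
      using D_le[of "z (Suc k)" "z' (Suc k)"] zW[of k] by linarith
    also have "\<dots> \<le> 2 * (\<bar>C\<bar> * ?e) + 2 * (\<bar>C'\<bar> * ?e)"
      by (intro add_mono mult_left_mono mult_right_mono) auto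
    also have "\<dots> = 2 * (\<bar>C\<bar> + \<bar>C'\<bar>) * ?e" by (simp add: algebra_simps)
    also have "\<dots> \<le> 2 * (\<bar>C\<bar> + \<bar>C'\<bar>) * exp (2 * \<nu> * \<sigma> * real (Suc k))"
      using pos by (intro mult_left_mono) auto
    finally have "G k \<le> exp (- 2 * \<nu> * \<sigma> * real (Suc k)) * (2 * (\<bar>C\<bar> + \<bar>C'\<bar>) * exp (2 * \<nu> * \<sigma> * real (Suc k)))"
      unfolding G_def by (intro mult_left_mono) auto
    also have "\<dots> = 2 * (\<bar>C\<bar> + \<bar>C'\<bar>) * (exp (- 2 * \<nu> * \<sigma> * real (Suc k)) * exp (2 * \<nu> * \<sigma> * real (Suc k)))"
      by (simp only: mult_ac)
    also have "exp (- 2 * \<nu> * \<sigma> * real (Suc k)) * exp (2 * \<nu> * \<sigma> * real (Suc k)) = 1"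
      by (simp only: exp_add[symmetric]) simp
    finally show ?thesis by simp
  qed
  \<comment> \<open>\<open>F (Suc k)\<close> is at least \<open>F k + \<delta> * G k\<close>, and
    \<open>G k\<close> is at least \<open>F k / K\<close>, so the growth factor is
    \<open>1 + \<delta> / K\<close>.\<close>
  define \<kappa> where "\<kappa> = \<delta> / K"
  have \<kappa>: "\<kappa> > 0" using K pos by (simp add: \<kappa>_def)
  have grow: "(1 + \<kappa>) * F k \<le> F (Suc k)" for k
  proof -
    have "\<kappa> * F k \<le> \<kappa> * (K * G k)" using FG[of k] \<kappa> by (intro mult_left_mono) auto
    then show ?thesis using F[of k] K by (simp add: \<kappa>_def algebra_simps)
  qed
  have pow: "(1 + \<kappa>) ^ n * F 1 \<le> F (Suc n)" for n
  proof (induction n)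
    case (Suc n)
    have "(1 + \<kappa>) ^ Suc n * F 1 \<le> (1 + \<kappa>) * F (Suc n)" using Suc \<kappa> by (simp add: mult.assoc)
    then show ?case using grow[of "Suc n"] by linarith
  qed simp
  \<comment> \<open>The sign is established at index 1, so that the step from 0 to 1 still leaves
    the term \<open>\<delta> * G 0\<close>, which is the quantitative part of the claim.\<close>
  have "F 1 \<le> 0"
  proof (rule ccontr)
    assume "\<not> F 1 \<le> 0"
    then have F1: "F 1 > 0" by simp
    define B where "B = K * (2 * (\<bar>C\<bar> + \<bar>C'\<bar>))"
    obtain n where n: "B / F 1 < (1 + \<kappa>) ^ n" using real_arch_pow[of "1 + \<kappa>"] \<kappa> by auto
    then have "B < (1 + \<kappa>) ^ n * F 1" using F1 by (simp add: field_simps)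
    also have "\<dots> \<le> F (Suc n)" by (rule pow)
    also have "\<dots> \<le> K * G (Suc n)" by (rule FG)
    also have "\<dots> \<le> B" unfolding B_def using Gb K by (intro mult_left_mono) auto
    finally show False by simp
  qed
  then have "F 0 + \<delta> * G 0 \<le> 0" using F[of 0] by simp
  moreover have "z 0 = u" "z' 0 = u'" using z z' by (auto simp: backward_def)
  ultimately show ?thesis by (simp add: F_def G_def mult_ac)
qed

lemma amenable_separation:
  assumes "amenable u" "amenable u'" "u \<noteq> u'"
  shows "V (u - u') < 0"
proof -
  obtain C z C' z' where z: "backward u C z" "backward u' C' z'" using assms by (auto simp: amenable_def)
  have T: "T (z 1) = u" "T (z' 1) = u'" using z by (auto simp: backward_def)
  then have "z 1 \<noteq> z' 1" using assms by auto
  have "V (u - u') \<le> 0" using backward_separation[OF z] D_nonneg[of "z 1" "z' 1"] pos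
    by (smt (verit) exp_gt_zero mult_nonneg_nonneg)
  have "D (z 1) (z' 1) \<noteq> 0"
  proof
    assume "D (z 1) (z' 1) = 0"
    moreover have "continuous_on {0..\<sigma>} (\<lambda>s. (norm (S s (z 1) - S s (z' 1)))\<^sup>2)"
      by (intro continuous_intros S_cont_t) auto
    ultimately have "\<forall>s\<in>{0..\<sigma>}. (norm (S s (z 1) - S s (z' 1)))\<^sup>2 = 0"
      using integral_eq_0_iff[of 0 \<sigma> "\<lambda>s. (norm (S s (z 1) - S s (z' 1)))\<^sup>2"] pos by (auto simp: D_def)
    from bspec[OF this, of 0] show False using \<open>z 1 \<noteq> z' 1\<close> pos S_0 by simp
  qed
  then have "0 < \<delta> * exp (- 2 * \<nu> * \<sigma>) * D (z 1) (z' 1)" using D_nonneg[of "z 1" "z' 1"] pos by simp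
  then show ?thesis using backward_separation[OF z] by linarith
qed

lemma amenable_pr_inj:
  assumes "amenable u" "amenable u'" "pr u = pr u'" shows "u = u'"
  using amenable_separation[OF assms(1,2)] form_neg_pr[of "u - u'"] assms(3) pr_diff by auto

lemma amenable_T:
  assumes "amenable u" shows "amenable (T u)"
proof -
  obtain C z where z: "backward u C z" using assms by (auto simp: amenable_def)
  \<comment> \<open>In the shifted backward orbit the entry 1 is \<open>u\<close> itself, which
    \<open>W u\<close> bounds.\<close>
  define C' where "C' = max (W u) C"
  have "C' \<ge> 0" using W_nonneg[of u] by (simp add: C'_def)
  have "W (case_nat (T u) z (Suc k)) \<le> C' * exp (2 * \<nu> * \<sigma> * real k)" for k
  proof (cases k)
    case 0
    then show ?thesis using z by (simp add: backward_def C'_def)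
  next
    case (Suc j)
    have "W (z (Suc j)) \<le> C * exp (2 * \<nu> * \<sigma> * real j)" using z by (simp add: backward_def)
    also have "\<dots> \<le> C' * exp (2 * \<nu> * \<sigma> * real j)" by (intro mult_right_mono) (auto simp: C'_def)
    also have "\<dots> \<le> C' * exp (2 * \<nu> * \<sigma> * real k)"
      using \<open>C' \<ge> 0\<close> pos Suc by (intro mult_left_mono) auto
    finally show ?thesis using Suc by simp
  qed
  moreover have "T (case_nat (T u) z (Suc k)) = case_nat (T u) z k" for k
    using z by (cases k) (auto simp: backward_def)
  ultimately have "backward (T u) C' (case_nat (T u) z)" unfolding backward_def by auto
  then show ?thesis by (auto simp: amenable_def)
qed

section \<open>Compactness along orbits\<close>

lemma convergent_later:
  assumes "0 \<le> s" "s \<le> t" "convergent (\<lambda>n. S s (y n))"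
  shows "convergent (\<lambda>n. S t (y n))"
proof -
  obtain h where h: "continuous_on UNIV h" "\<And>u. S t u = h (S s u)" using S_factor[OF assms(1,2)] by blast
  obtain l where "(\<lambda>n. S s (y n)) \<longlonglongrightarrow> l" using assms(3) by (auto simp: convergent_def)
  then have "(\<lambda>n. h (S s (y n))) \<longlonglongrightarrow> h l"
    using h(1) by (auto simp: continuous_on_eq_continuous_at intro: isCont_tendsto_compose)
  then show ?thesis unfolding h(2) by (auto simp: convergent_def)
qed

lemma bounded_state_subseq:
  assumes "\<And>n. W (y n) \<le> C"
  obtains t r where "t \<in> {0..\<sigma>}" "strict_mono (r::nat\<Rightarrow>nat)" "bounded (range (\<lambda>n. S t (y (r n))))"
proof -
  obtain t r B where t: "t \<in> {0..\<sigma>}" "strict_mono r" "\<And>n::nat. (norm (S t (y (r n))))\<^sup>2 \<le> B"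
  proof (rule bounded_integrals_bounded_subseq[of 0 \<sigma> "\<lambda>n t. (norm (S t (y n)))\<^sup>2" C])
    show "continuous_on {0..\<sigma>} (\<lambda>t. (norm (S t (y n)))\<^sup>2)" for n
      by (intro continuous_intros S_cont_t) auto
    show "integral {0..\<sigma>} (\<lambda>t. (norm (S t (y n)))\<^sup>2) \<le> C" for n using assms[of n] by (simp add: W_def)
  qed (use pos in auto)
  have "bounded (range (\<lambda>n. S t (y (r n))))"
    unfolding bounded_iff using t(3) by (auto intro!: exI[of _ "sqrt B"] real_le_rsqrt)
  then show thesis using that t by blast
qed

text \<open>If \<open>P\<close> is compact, \<open>V\<close> of differences tends to 0 at time \<open>t\<close>, while at time \<open>m \<sigma>\<close> it is bounded below by
  the projections; squeezing then gives convergence in mean square in between.\<close>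

lemma Cauchy_from_form:
  assumes m: "2 \<le> m" and t: "t \<in> {0..\<sigma>}"
    and B: "\<And>n. norm (S t (w n)) \<le> B" and Pc: "Cauchy (\<lambda>n. P (S t (w n)))"
    and pc: "Cauchy (\<lambda>n. pr ((T ^^ m) (w n)))" and e: "0 < e"
  shows "\<exists>M. \<forall>i\<ge>M. \<forall>j\<ge>M. integral {\<sigma>..2*\<sigma>} (\<lambda>s. (norm (S s (w i) - S s (w j)))\<^sup>2) < e"
proof -
  define E where "E = exp (2 * \<nu> * (real m * \<sigma>))"
  have E: "E \<ge> 1" using pos by (simp add: E_def)
  have B0: "B \<ge> 0" using B[of 0] norm_ge_zero order_trans by blast
  \<comment> \<open>\<open>Q * \<eta>\<close> bounds the drop of the weighted form from
    \<open>t\<close> to \<open>m \<sigma>\<close>: the part \<open>2 * B\<close> comes from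
    \<open>V d \<le> norm (P d) * norm d\<close> at the start, the part \<open>Cp\<close> from the
    projection at the end, where \<open>\<eta> \<le> 1\<close> reduces the square.\<close>
  define Q where "Q = E * (2 * B + Cp)"
  have Q: "Q > 0" using E B0 pos by (simp add: Q_def add_nonneg_pos)
  define \<eta> where "\<eta> = min 1 (\<delta> * e / (2 * Q))"
  have \<eta>: "0 < \<eta>" "\<eta> \<le> 1" "Q * \<eta> < \<delta> * e"
  proof -
    have "Q * \<eta> \<le> Q * (\<delta> * e / (2 * Q))" using Q by (intro mult_left_mono) (auto simp: \<eta>_def)
    also have "\<dots> < \<delta> * e" using Q pos e by simp
    finally show "Q * \<eta> < \<delta> * e" .
  qed (use Q pos e in \<open>auto simp: \<eta>_def\<close>)
  obtain M1 where M1: "\<And>i j. i \<ge> M1 \<Longrightarrow> j \<ge> M1 \<Longrightarrow> dist (P (S t (w i))) (P (S t (w j))) < \<eta>"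
    using Pc \<eta>(1) unfolding Cauchy_def by meson
  obtain M2 where M2: "\<And>i j. i \<ge> M2 \<Longrightarrow> j \<ge> M2 \<Longrightarrow> dist (pr ((T ^^ m) (w i))) (pr ((T ^^ m) (w j))) < \<eta>"
    using pc \<eta>(1) unfolding Cauchy_def by meson
  have "integral {\<sigma>..2*\<sigma>} (\<lambda>s. (norm (S s (w i) - S s (w j)))\<^sup>2) < e" if ij: "i \<ge> max M1 M2" "j \<ge> max M1 M2" for i j
  proof -
    let ?I = "integral {t..real m * \<sigma>} (\<lambda>s. (norm (S s (w i) - S s (w j)))\<^sup>2)"
    have tm: "0 \<le> t" "t \<le> \<sigma>" "2 * \<sigma> \<le> real m * \<sigma>"
      using m t pos by auto
    then have tm': "t \<le> real m * \<sigma>" using pos by linarith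
    have I0: "?I \<ge> 0" by (rule integral_nonneg[OF int_diff]) (use tm in auto)
    have sub: "integral {\<sigma>..2*\<sigma>} (\<lambda>s. (norm (S s (w i) - S s (w j)))\<^sup>2) \<le> ?I"
      by (rule integral_subset_le) (use tm pos int_diff in auto)
    define d where "d = S t (w i) - S t (w j)"
    have Pd: "norm (P d) < \<eta>" using M1[of i j] ij P unfolding d_def
      by (simp add: dist_norm linear_diff bounded_linear.linear)
    have nd: "norm d \<le> 2 * B" unfolding d_def
      using norm_triangle_ineq4[of "S t (w i)" "S t (w j)"] B[of i] B[of j] by linarith
    have "V d \<le> norm (P d) * norm d" unfolding quad_form_def by (rule norm_cauchy_schwarz)
    also have "\<dots> \<le> \<eta> * (2 * B)" using Pd nd B0 \<eta>(1) by (intro mult_mono) auto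
    finally have Vd: "V d \<le> \<eta> * (2 * B)" .
    define d' where "d' = (T ^^ m) (w i) - (T ^^ m) (w j)"
    have "norm (pr d') < \<eta>" using M2[of i j] ij by (simp add: d'_def pr_diff dist_norm)
    then have "(norm (pr d'))\<^sup>2 \<le> \<eta>\<^sup>2" by (intro power_mono) auto
    also have "\<dots> \<le> \<eta>" using \<eta> by (simp add: power2_eq_square mult_left_le)
    finally have "Cp * (norm (pr d'))\<^sup>2 \<le> Cp * \<eta>" using pos by (intro mult_left_mono) auto
    then have Vd': "- V d' \<le> Cp * \<eta>" using form_lower[of d'] by linarith
    have "E * V d' + \<delta> * exp (2 * \<nu> * t) * ?I \<le> exp (2 * \<nu> * t) * V d"
      using squeeze_weak[of t "real m * \<sigma>" "w i" "w j"] tm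
      by (simp add: E_def d_def d'_def S_period)
    moreover have "\<delta> * ?I \<le> \<delta> * exp (2 * \<nu> * t) * ?I"
      using pos tm I0 by (intro mult_right_mono) auto
    moreover have "exp (2 * \<nu> * t) * V d \<le> exp (2 * \<nu> * t) * (\<eta> * (2 * B))"
      using Vd by (intro mult_left_mono) auto
    moreover have "exp (2 * \<nu> * t) * (\<eta> * (2 * B)) \<le> E * (\<eta> * (2 * B))"
      using tm tm' pos \<eta> B0 unfolding E_def by (intro mult_right_mono) auto
    moreover have "E * (- V d') \<le> E * (Cp * \<eta>)" using Vd' E by (intro mult_left_mono) auto
    moreover have "Q * \<eta> = E * (\<eta> * (2 * B)) + E * (Cp * \<eta>)" by (simp add: Q_def algebra_simps)
    ultimately have "\<delta> * ?I \<le> Q * \<eta>" by (simp only: mult_minus_right)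
    then have "\<delta> * ?I < \<delta> * e" using \<eta>(3) by linarith
    then have "?I < e" using pos by simp
    then show ?thesis using sub by linarith
  qed
  then show ?thesis by blast
qed

text \<open>\<open>K\<close> is uniform in the sequence, which lets chains be entered a fixed number
  of steps back. For compact \<open>P\<close>, the first period offers a time with bounded states
  and the second a time with convergence; for compact time maps, \<open>K\<close> periods must
  outlast one period plus the compactness time.\<close>

lemma state_convergence:
  obtains K where "1 \<le> K"
    "\<And>m y C. K \<le> m \<Longrightarrow> (\<And>n. W (y n) \<le> C) \<Longrightarrow> convergent (\<lambda>n. pr ((T ^^ m) (y n))) \<Longrightarrow>
       \<exists>r. strict_mono (r::nat\<Rightarrow>nat) \<and> convergent (\<lambda>n. (T ^^ K) (y (r n)))"
  using compactness
proof
  assume cP: "\<forall>y. bounded (range y) \<longrightarrow> (\<exists>r. strict_mono (r::nat\<Rightarrow>nat) \<and> convergent (\<lambda>n. P (y (r n))))"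
  have "\<exists>r. strict_mono (r::nat\<Rightarrow>nat) \<and> convergent (\<lambda>n. (T ^^ 2) (y (r n)))"
    if m: "2 \<le> m" and W: "\<And>n. W (y n) \<le> C" and cv: "convergent (\<lambda>n. pr ((T ^^ m) (y n)))" for m y C
  proof -
    obtain t and r :: "nat \<Rightarrow> nat" where t: "t \<in> {0..\<sigma>}" "strict_mono r" "bounded (range (\<lambda>n. S t (y (r n))))"
      by (rule bounded_state_subseq[of y, OF W])
    from cP[rule_format, of "\<lambda>n. S t (y (r n))", OF t(3)] obtain r' where r': "strict_mono (r'::nat\<Rightarrow>nat)" "convergent (\<lambda>n. P (S t (y (r (r' n)))))"
      by (elim exE conjE) (rule that)
    define w where "w = (\<lambda>n. y (r (r' n)))"
    obtain B where "\<And>n. norm (S t (y (r n))) \<le> B" using t(3) by (auto simp: bounded_iff)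
    then have B: "norm (S t (w n)) \<le> B" for n by (simp add: w_def)
    have "convergent (\<lambda>n. pr ((T ^^ m) (w n)))"
      using convergent_subseq_convergent[OF cv strict_mono_o[OF t(2) r'(1)]] by (simp add: w_def comp_def)
    then have pc: "Cauchy (\<lambda>n. pr ((T ^^ m) (w n)))" by (rule convergent_Cauchy)
    have Pc: "Cauchy (\<lambda>n. P (S t (w n)))" using r'(2) unfolding w_def by (rule convergent_Cauchy)
    obtain t' and r'' :: "nat \<Rightarrow> nat" where t': "t' \<in> {\<sigma>..2*\<sigma>}" "strict_mono r''" "convergent (\<lambda>n. S t' (w (r'' n)))"
    proof (rule integral_Cauchy_subseq[of \<sigma> "2*\<sigma>" "\<lambda>n s. S s (w n)"])
      show "continuous_on {\<sigma>..2*\<sigma>} (\<lambda>s. S s (w n))" for n by (rule S_cont_t) (use pos in auto)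
    qed (use pos Cauchy_from_form[OF m t(1) B Pc pc] in auto)
    have "convergent (\<lambda>n. S (real 2 * \<sigma>) (w (r'' n)))"
      by (rule convergent_later[of t' _ "\<lambda>n. w (r'' n)", OF _ _ t'(3)]) (use t' pos in auto)
    then have "convergent (\<lambda>n. (T ^^ 2) (w (r'' n)))" unfolding S_period .
    then show ?thesis unfolding w_def
      by (intro exI[of _ "\<lambda>n. r (r' (r'' n))"])
         (use t r' t' in \<open>simp add: strict_mono_def\<close>)
  qed
  then show thesis by (rule that[of 2, rotated]) simp_all
next
  assume "\<exists>\<tau>>0. \<forall>s\<ge>0. \<forall>y. bounded (range (\<lambda>n. S s (y n))) \<longrightarrow>
           (\<exists>r. strict_mono (r::nat\<Rightarrow>nat) \<and> convergent (\<lambda>n. S (s + \<tau>) (y (r n))))"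
  then obtain \<tau> where \<tau>: "0 < \<tau>" "\<forall>s\<ge>0. \<forall>y. bounded (range (\<lambda>n. S s (y n))) \<longrightarrow>
           (\<exists>r. strict_mono (r::nat\<Rightarrow>nat) \<and> convergent (\<lambda>n. S (s + \<tau>) (y (r n))))"
    by (elim exE conjE) (rule that)
  obtain K :: nat where K: "1 + \<tau> / \<sigma> < real K" using reals_Archimedean2 by blast
  have K\<sigma>: "\<sigma> + \<tau> \<le> real K * \<sigma>"
  proof -
    have "(1 + \<tau> / \<sigma>) * \<sigma> = \<sigma> + \<tau>" using pos by (simp add: distrib_right)
    then show ?thesis using mult_right_mono[OF less_imp_le[OF K], of \<sigma>] pos by simp
  qed
  have conv: "\<exists>r. strict_mono (r::nat\<Rightarrow>nat) \<and> convergent (\<lambda>n. (T ^^ K) (y (r n)))"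
    if W: "\<And>n. W (y n) \<le> C" for y C
  proof -
    obtain t and r :: "nat \<Rightarrow> nat" where t: "t \<in> {0..\<sigma>}" "strict_mono r" "bounded (range (\<lambda>n. S t (y (r n))))"
      by (rule bounded_state_subseq[of y, OF W])
    have "0 \<le> t" using t(1) by simp
    from \<tau>(2)[rule_format, of t "\<lambda>n. y (r n)", OF this t(3)]
    obtain r' where r': "strict_mono (r'::nat\<Rightarrow>nat)" "convergent (\<lambda>n. S (t + \<tau>) (y (r (r' n))))"
      by (elim exE conjE) (rule that)
    have "convergent (\<lambda>n. S (real K * \<sigma>) (y (r (r' n))))"
      by (rule convergent_later[of "t + \<tau>" _ "\<lambda>n. y (r (r' n))", OF _ _ r'(2)]) (use t \<tau> K\<sigma> in auto)
    then show ?thesis unfolding S_period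
      by (intro exI[of _ "\<lambda>n. r (r' n)"]) (use t r' in \<open>simp add: strict_mono_def\<close>)
  qed
  have K1: "1 \<le> K"
  proof -
    have "\<tau> / \<sigma> > 0" using \<tau> pos by simp
    then show ?thesis using K by linarith
  qed
  show thesis by (rule that[OF K1]) (rule conv)
qed

section \<open>The planar set of amenable points\<close>

definition chain :: "real \<Rightarrow> nat \<Rightarrow> (nat \<Rightarrow> 'h) \<Rightarrow> bool" where
  "chain C n z \<longleftrightarrow> (\<forall>k<n. T (z (Suc k)) = z k \<and> W (z (Suc k)) \<le> C * exp (2 * \<nu> * \<sigma> * real k))"

text \<open>Forward iteration provides only finite chains. Limits of their initial points have a
  preimage of the same kind, so an infinite backward orbit is built by repeated choice of
  preimages.\<close>

definition "approximable C u \<longleftrightarrow> (\<exists>z. (\<forall>n. chain C n (z n)) \<and> (\<lambda>n. z n 0) \<longlonglongrightarrow> u)"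

lemma chain_mono: "chain C n z \<Longrightarrow> m \<le> n \<Longrightarrow> chain C m z"
  by (simp add: chain_def)

lemma chain_funpow: "chain C n z \<Longrightarrow> j + k \<le> n \<Longrightarrow> (T ^^ k) (z (j + k)) = z j"
proof (induction k)
  case (Suc k)
  then have "T (z (Suc (j + k))) = z (j + k)" by (simp add: chain_def)
  then show ?case using Suc by (simp add: funpow_swap1)
qed simp

text \<open>The preimage is the limit of the entries 1 of the chains. Dropping the entry 0 shifts
  the exponent by one, which the new constant absorbs.\<close>

lemma approximable_step:
  assumes "approximable C u"
  shows "\<exists>v. approximable (C * exp (2 * \<nu> * \<sigma>)) v \<and> T v = u \<and> W v \<le> C"
proof -
  obtain z where z: "\<And>n. chain C n (z n)" "(\<lambda>n. z n 0) \<longlonglongrightarrow> u"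
    using assms by (auto simp: approximable_def)
  obtain K where K: "1 \<le> K"
    "\<And>m y C. K \<le> m \<Longrightarrow> (\<And>n. W (y n) \<le> C) \<Longrightarrow> convergent (\<lambda>n. pr ((T ^^ m) (y n))) \<Longrightarrow>
       \<exists>r. strict_mono (r::nat\<Rightarrow>nat) \<and> convergent (\<lambda>n. (T ^^ K) (y (r n)))"
    using state_convergence by blast
  \<comment> \<open>Entry \<open>Suc K\<close> is chosen so that \<open>K\<close> iterations, after
    which a subsequence converges, end at entry 1; one more ends at entry 0, whose projections
    converge.\<close>
  define y where "y = (\<lambda>n. z (n + Suc K) (Suc K))"
  have z': "chain C (n + Suc K) (z (n + Suc K))" for n by (rule z(1))
  have Wy: "W (y n) \<le> C * exp (2 * \<nu> * \<sigma> * real K)" for n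
    using z'[of n] unfolding chain_def y_def by simp
  have "(T ^^ Suc K) (y n) = z (n + Suc K) 0" for n
    using chain_funpow[OF z'[of n], of 0 "Suc K"] by (simp add: y_def)
  moreover have "(\<lambda>n. z (n + Suc K) 0) \<longlonglongrightarrow> u" using LIMSEQ_ignore_initial_segment[OF z(2)] .
  ultimately have "(\<lambda>n. pr ((T ^^ Suc K) (y n))) \<longlonglongrightarrow> pr u"
    using bounded_linear.tendsto[OF pr] by simp
  then have "convergent (\<lambda>n. pr ((T ^^ Suc K) (y n)))" by (auto simp: convergent_def)
  from K(2)[of "Suc K" y, OF _ Wy this] obtain r where r: "strict_mono (r::nat\<Rightarrow>nat)" "convergent (\<lambda>n. (T ^^ K) (y (r n)))"
    by auto
  have yK: "(T ^^ K) (y n) = z (n + Suc K) 1" for n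
    using chain_funpow[OF z'[of n], of 1 K] by (simp add: y_def)
  obtain v where v: "(\<lambda>n. z (r n + Suc K) 1) \<longlonglongrightarrow> v" using r(2) by (auto simp: yK convergent_def)
  have "(\<lambda>n. T (z (r n + Suc K) 1)) \<longlonglongrightarrow> T v" using v by (rule T_tendsto)
  moreover have "T (z (r n + Suc K) 1) = z (r n + Suc K) 0" for n using z'[of "r n"] by (simp add: chain_def)
  moreover have "(\<lambda>n. z (r n + Suc K) 0) \<longlonglongrightarrow> u"
    using LIMSEQ_subseq_LIMSEQ[OF z(2), of "\<lambda>n. r n + Suc K"] r(1) by (simp add: comp_def strict_mono_def)
  ultimately have "T v = u" using LIMSEQ_unique by auto
  moreover have "W v \<le> C"
  proof (rule LIMSEQ_le_const2[OF W_tendsto[OF v]])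
    have "W (z (r n + Suc K) 1) \<le> C" for n using z'[of "r n"] by (auto simp: chain_def)
    then show "\<exists>N. \<forall>n\<ge>N. W (z (r n + Suc K) 1) \<le> C" by blast
  qed
  moreover have "approximable (C * exp (2 * \<nu> * \<sigma>)) v" unfolding approximable_def
  proof (intro exI[of _ "\<lambda>n k. z (r n + Suc K) (Suc k)"] conjI allI)
    show "chain (C * exp (2 * \<nu> * \<sigma>)) n (\<lambda>k. z (r n + Suc K) (Suc k))" for n
      unfolding chain_def
    proof (intro allI impI)
      fix k assume "k < n"
      then have "Suc k < r n + Suc K" using seq_suble[OF r(1), of n] by simp
      then have "T (z (r n + Suc K) (Suc (Suc k))) = z (r n + Suc K) (Suc k)"
        "W (z (r n + Suc K) (Suc (Suc k))) \<le> C * exp (2 * \<nu> * \<sigma> * real (Suc k))"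
        using z'[of "r n"] unfolding chain_def by blast+
      moreover have "exp (2 * \<nu> * \<sigma> * real (Suc k)) = exp (2 * \<nu> * \<sigma>) * exp (2 * \<nu> * \<sigma> * real k)"
        by (simp add: exp_add[symmetric] algebra_simps)
      ultimately show "T (z (r n + Suc K) (Suc (Suc k))) = z (r n + Suc K) (Suc k) \<and>
          W (z (r n + Suc K) (Suc (Suc k))) \<le> C * exp (2 * \<nu> * \<sigma>) * exp (2 * \<nu> * \<sigma> * real k)"
        by (simp only: mult.assoc)
    qed
    show "(\<lambda>n. z (r n + Suc K) (Suc 0)) \<longlonglongrightarrow> v" using v by simp
  qed
  ultimately show ?thesis by blast
qed

lemma approximable_amenable:
  assumes "approximable C u" shows "amenable u"
proof -
  have "\<exists>z. \<forall>k. (approximable (C * exp (2 * \<nu> * \<sigma> * real k)) (z k) \<and> (k = 0 \<longrightarrow> z k = u)) \<and>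
      (T (z (Suc k)) = z k \<and> W (z (Suc k)) \<le> C * exp (2 * \<nu> * \<sigma> * real k))"
  proof (rule dependent_nat_choice)
    show "\<exists>x. approximable (C * exp (2 * \<nu> * \<sigma> * real 0)) x \<and> (0 = (0::nat) \<longrightarrow> x = u)"
      using assms by auto
    fix x and k :: nat
    assume "approximable (C * exp (2 * \<nu> * \<sigma> * real k)) x \<and> (k = 0 \<longrightarrow> x = u)"
    then obtain v where v: "approximable (C * exp (2 * \<nu> * \<sigma> * real k) * exp (2 * \<nu> * \<sigma>)) v" "T v = x"
      "W v \<le> C * exp (2 * \<nu> * \<sigma> * real k)" using approximable_step by blast
    have "C * exp (2 * \<nu> * \<sigma> * real k) * exp (2 * \<nu> * \<sigma>) = C * exp (2 * \<nu> * \<sigma> * real (Suc k))"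
      by (simp add: exp_add[symmetric] algebra_simps)
    with v(1) have "approximable (C * exp (2 * \<nu> * \<sigma> * real (Suc k))) v" by (simp only:)
    then show "\<exists>y. (approximable (C * exp (2 * \<nu> * \<sigma> * real (Suc k))) y \<and> (Suc k = 0 \<longrightarrow> y = u)) \<and>
        T y = x \<and> W y \<le> C * exp (2 * \<nu> * \<sigma> * real k)" using v(2,3) by blast
  qed
  then obtain z where "\<forall>k. (approximable (C * exp (2 * \<nu> * \<sigma> * real k)) (z k) \<and> (k = 0 \<longrightarrow> z k = u)) \<and>
      (T (z (Suc k)) = z k \<and> W (z (Suc k)) \<le> C * exp (2 * \<nu> * \<sigma> * real k))" ..
  then have "backward u C z" by (simp add: backward_def)
  then show ?thesis by (auto simp: amenable_def)
qed

text \<open>Only projections of the initial points are known to converge. The mean square bound at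
  entry \<open>K\<close> supplies the compactness that turns this into convergence of the points
  themselves along a subsequence.\<close>

lemma chain_limit:
  assumes z: "\<And>n. chain C n (z n)" and cv: "convergent (\<lambda>n. pr (z n 0))"
  obtains r u where "strict_mono (r::nat\<Rightarrow>nat)" "(\<lambda>n. z (r n) 0) \<longlonglongrightarrow> u" "amenable u"
proof -
  obtain K where K: "1 \<le> K"
    "\<And>m y C. K \<le> m \<Longrightarrow> (\<And>n. W (y n) \<le> C) \<Longrightarrow> convergent (\<lambda>n. pr ((T ^^ m) (y n))) \<Longrightarrow>
       \<exists>r. strict_mono (r::nat\<Rightarrow>nat) \<and> convergent (\<lambda>n. (T ^^ K) (y (r n)))"
    using state_convergence by blast
  define y where "y = (\<lambda>n. z (n + K) K)"
  have z': "chain C (n + K) (z (n + K))" for n by (rule z)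
  have Wy: "W (y n) \<le> C * exp (2 * \<nu> * \<sigma> * real (K - 1))" for n
  proof -
    obtain j where "K = Suc j" using K(1) by (cases K) auto
    then show ?thesis using z'[of n] unfolding chain_def y_def by simp
  qed
  have yK: "(T ^^ K) (y n) = z (n + K) 0" for n
    using chain_funpow[OF z'[of n], of 0 K] by (simp add: y_def)
  have "convergent (\<lambda>n. pr ((T ^^ K) (y n)))"
    unfolding yK using convergent_subseq_convergent[OF cv, of "\<lambda>n. n + K"] by (simp add: comp_def strict_mono_def)
  from K(2)[OF order_refl Wy this] obtain r where r: "strict_mono (r::nat\<Rightarrow>nat)" "convergent (\<lambda>n. z (r n + K) 0)"
    unfolding yK by blast
  then obtain u where u: "(\<lambda>n. z (r n + K) 0) \<longlonglongrightarrow> u" by (auto simp: convergent_def)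
  have "approximable C u" unfolding approximable_def
    by (intro exI[of _ "\<lambda>n. z (r n + K)"] conjI allI u chain_mono[OF z])
       (use seq_suble[OF r(1)] in \<open>auto intro: trans_le_add1\<close>)
  then show thesis
    using that[of "\<lambda>n. r n + K" u] u r(1) approximable_amenable by (auto simp: strict_mono_def)
qed

text \<open>Differences of points of an affine copy of \<open>H^-\<close> start with form at most
  \<open>- c\<close> times the squared distance. The weighted form cannot increase, and
  \<open>form_lower\<close> converts its negativity into expansion of the projections, with a factor
  \<open>a\<close> depending on \<open>N\<close>.\<close>

lemma pr_funpow_surj: "surj (\<lambda>\<zeta>. pr ((T ^^ N) (p + J \<zeta>)))"
proof -
  define a where "a = sqrt (c / (exp (2 * \<nu> * (real N * \<sigma>)) * Cp))"
  show ?thesis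
  proof (rule expanding_plane_map_surj)
    show "0 < a" using pos by (simp add: a_def)
    have "continuous_on UNIV (\<lambda>\<zeta>. S (real N * \<sigma>) (p + J \<zeta>))"
      by (intro S_cont_compose continuous_intros bounded_linear.continuous_on[OF J]) (use pos in auto)
    then show "continuous_on UNIV (\<lambda>\<zeta>. pr ((T ^^ N) (p + J \<zeta>)))"
      unfolding S_period by (rule bounded_linear.continuous_on[OF pr])
    fix x y
    let ?d = "(T ^^ N) (p + J x) - (T ^^ N) (p + J y)"
    let ?E = "exp (2 * \<nu> * (real N * \<sigma>))"
    have "?E * V ?d \<le> V (J (x - y))"
      using form_antimono[of 0 "real N * \<sigma>" "p + J x" "p + J y"] pos J
      by (simp add: S_0 S_period linear_diff bounded_linear.linear)
    moreover have "?E * (- Cp * (norm (pr ?d))\<^sup>2) \<le> ?E * V ?d"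
      by (rule mult_left_mono[OF form_lower]) simp
    ultimately have "c * (norm (x - y))\<^sup>2 \<le> ?E * Cp * (norm (pr ?d))\<^sup>2"
      using form_J[of "x - y"] by (simp add: mult.assoc)
    then have "a\<^sup>2 * (norm (x - y))\<^sup>2 \<le> (norm (pr ?d))\<^sup>2"
      using pos by (simp add: a_def divide_le_eq mult.commute)
    then have "(a * norm (x - y))\<^sup>2 \<le> (norm (pr ?d))\<^sup>2" by (simp add: power_mult_distrib)
    then have "a * norm (x - y) \<le> norm (pr ?d)" by (rule power2_le_imp_le) simp
    then show "a * norm (x - y) \<le> norm (pr ((T ^^ N) (p + J x)) - pr ((T ^^ N) (p + J y)))"
      by (simp add: pr_diff)
  qed
qed

lemma W_orbit_le:
  assumes M: "\<And>t. 0 \<le> t \<Longrightarrow> norm (S t p) \<le> M"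
  shows "W ((T ^^ j) p) \<le> \<sigma> * M\<^sup>2"
proof -
  have "W ((T ^^ j) p) \<le> integral {0..\<sigma>} (\<lambda>t. M\<^sup>2)" unfolding W_def
  proof (intro integral_le W_int)
    show "(norm (S t ((T ^^ j) p)))\<^sup>2 \<le> M\<^sup>2" if "t \<in> {0..\<sigma>}" for t
      using that pos M[of "t + real j * \<sigma>"] S_funpow[of t j p] by (intro power_mono) auto
  qed (auto intro: integrable_const_ivl)
  then show ?thesis using pos by simp
qed

text \<open>The points \<open>p + J (\<zeta> N)\<close> are aimed to project onto \<open>x\<close>
  after \<open>N\<close> periods. Against the bounded orbit of \<open>p\<close> the form of the
  difference is at most 0 all along and at least \<open>- Cp * q^2\<close> at the end, so squeezing
  bounds the mean square of the difference backward from the end, uniformly in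
  \<open>N\<close>.\<close>

lemma amenable_onto:
  assumes M: "\<And>t. 0 \<le> t \<Longrightarrow> norm (S t p) \<le> M"
  shows "\<exists>u. amenable u \<and> pr u = x"
proof -
  obtain B where B: "\<And>u. norm (pr u) \<le> norm u * B" "B > 0"
    using bounded_linear.pos_bounded[OF pr] by blast
  define q where "q = norm x + M * B"
  have "\<exists>\<zeta>. pr ((T ^^ N) (p + J \<zeta>)) = x" for N
    using surjD[OF pr_funpow_surj[of N p], of x] by force
  then have "\<forall>N. \<exists>\<zeta>. pr ((T ^^ N) (p + J \<zeta>)) = x" by blast
  from choice[OF this] obtain \<zeta> where \<zeta>: "\<And>N. pr ((T ^^ N) (p + J (\<zeta> N))) = x" by blast
  \<comment> \<open>Entries count backward from the end: \<open>z N k\<close> lies \<open>k\<close>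
    periods before time \<open>N \<sigma>\<close>.\<close>
  define z where "z = (\<lambda>N k. (T ^^ (N - k)) (p + J (\<zeta> N)))"
  define A where "A = Cp * q\<^sup>2 / \<delta>"
  have A: "A \<ge> 0" using pos by (simp add: A_def)
  define C where "C = 2 * A * exp (2 * \<nu> * \<sigma>) + 2 * (\<sigma> * M\<^sup>2)"
  have "chain C N (z N)" for N unfolding chain_def
  proof (intro allI impI conjI)
    fix k assume k: "k < N"
    define j where "j = N - Suc k"
    have Nj: "N - k = Suc j" "N = Suc k + j" using k by (auto simp: j_def)
    show "T (z N (Suc k)) = z N k" by (simp add: z_def Nj(1) flip: j_def)
    define v1 where "v1 = (T ^^ j) (p + J (\<zeta> N))"
    define v2 where "v2 = (T ^^ j) p"
    have v: "(T ^^ Suc k) v1 = (T ^^ N) (p + J (\<zeta> N))" "(T ^^ Suc k) v2 = (T ^^ N) p"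
      unfolding v1_def v2_def Nj(2) by (simp_all only: funpow_add comp_apply)
    have "exp (2 * \<nu> * (real j * \<sigma>)) * V (v1 - v2) \<le> V (J (\<zeta> N))"
      using form_antimono[of 0 "real j * \<sigma>" "p + J (\<zeta> N)" p] pos
      by (simp add: S_0 S_period v1_def v2_def)
    also have "\<dots> \<le> 0" using form_J[of "\<zeta> N"] pos by (simp add: order_trans)
    finally have V0: "V (v1 - v2) \<le> 0" by (simp add: mult_le_0_iff not_le)
    let ?E = "exp (2 * \<nu> * (real (Suc k) * \<sigma>))"
    let ?d = "(T ^^ Suc k) v1 - (T ^^ Suc k) v2"
    let ?I = "integral {0..real (Suc k) * \<sigma>} (\<lambda>s. (norm (S s v1 - S s v2))\<^sup>2)"
    have "norm (pr ?d) \<le> q"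
    proof -
      have "norm ((T ^^ N) p) \<le> M" using M[of "real N * \<sigma>"] pos by (simp add: S_period)
      then have "norm (pr ((T ^^ N) p)) \<le> M * B" 
        using order_trans[OF B(1) mult_right_mono[OF _ less_imp_le[OF B(2)]]] by blast
      then show ?thesis
        using norm_triangle_ineq4[of x "pr ((T ^^ N) p)"] unfolding v pr_diff \<zeta> q_def by linarith
    qed
    then have "Cp * (norm (pr ?d))\<^sup>2 \<le> Cp * q\<^sup>2" using pos by (intro mult_left_mono power_mono) auto
    then have "- (Cp * q\<^sup>2) \<le> V ?d" using form_lower[of ?d] by linarith
    then have "?E * - (Cp * q\<^sup>2) \<le> ?E * V ?d" by (intro mult_left_mono) auto
    moreover have "?E * V ?d + \<delta> * ?I \<le> V (v1 - v2)"
      using squeeze_weak[of 0 "real (Suc k) * \<sigma>" v1 v2] pos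
      unfolding S_period S_0 by simp
    ultimately have "\<delta> * ?I \<le> ?E * (Cp * q\<^sup>2)" using V0 by linarith
    then have I: "?I \<le> ?E * A" using pos by (simp add: A_def field_simps)
    have "D v1 v2 \<le> ?I" unfolding D_def
      by (rule integral_subset_le) (use pos int_diff in auto)
    moreover have "W v1 \<le> 2 * D v1 v2 + 2 * W v2" by (rule W_le)
    moreover have "W v2 \<le> \<sigma> * M\<^sup>2" unfolding v2_def by (rule W_orbit_le[OF M])
    ultimately have "W v1 \<le> 2 * (?E * A) + 2 * (\<sigma> * M\<^sup>2)" using I by linarith
    also have "?E = exp (2 * \<nu> * \<sigma>) * exp (2 * \<nu> * \<sigma> * real k)"
      by (simp add: exp_add[symmetric] algebra_simps)
    also have "2 * (\<sigma> * M\<^sup>2) \<le> 2 * (\<sigma> * M\<^sup>2) * exp (2 * \<nu> * \<sigma> * real k)"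
      using mult_left_mono[of 1 "exp (2 * \<nu> * \<sigma> * real k)" "2 * (\<sigma> * M\<^sup>2)"] pos by simp
    finally show "W (z N (Suc k)) \<le> C * exp (2 * \<nu> * \<sigma> * real k)"
      by (simp add: C_def z_def v1_def j_def algebra_simps)
  qed
  moreover have z0: "pr (z n 0) = x" for n using \<zeta> by (simp add: z_def)
  then have "convergent (\<lambda>n. pr (z n 0))" by (simp add: convergent_const)
  ultimately obtain r u where r: "strict_mono (r::nat\<Rightarrow>nat)" "(\<lambda>n. z (r n) 0) \<longlonglongrightarrow> u" "amenable u"
    by (rule chain_limit)
  have "(\<lambda>n. pr (z (r n) 0)) \<longlonglongrightarrow> pr u" using bounded_linear.tendsto[OF pr r(2)] .
  then have "pr u = x" by (simp add: z0 LIMSEQ_const_iff)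
  then show ?thesis using r(3) by blast
qed

text \<open>The point is a limit of iterates of \<open>p\<close>. The stretches of the orbit
  preceding these iterates are chains of growing length, since \<open>r0 n\<close> is at least
  \<open>n\<close>, and the norm bound passes to the limit.\<close>

lemma amenable_bounded_orbit:
  assumes M: "\<And>t. 0 \<le> t \<Longrightarrow> norm (S t p) \<le> M"
  shows "\<exists>u. amenable u \<and> (\<forall>n. norm ((T ^^ n) u) \<le> M)"
proof -
  have Tp: "norm ((T ^^ n) p) \<le> M" for n using M[of "real n * \<sigma>"] pos by (simp add: S_period)
  obtain B where B: "\<And>u. norm (pr u) \<le> norm u * B" "B > 0"
    using bounded_linear.pos_bounded[OF pr] by blast
  have "bounded (range (\<lambda>n. pr ((T ^^ n) p)))" unfolding bounded_iff
    using order_trans[OF B(1) mult_right_mono[OF Tp less_imp_le[OF B(2)]]] by blast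
  then obtain r0 where r0: "strict_mono (r0::nat\<Rightarrow>nat)" "convergent (\<lambda>n. pr ((T ^^ r0 n) p))"
    using bounded_imp_convergent_subsequence[of "\<lambda>n. pr ((T ^^ n) p)"] by (auto simp: comp_def convergent_def)
  have "chain (\<sigma> * M\<^sup>2) n (\<lambda>k. (T ^^ (r0 n - k)) p)" for n unfolding chain_def
  proof (intro allI impI conjI)
    fix k assume "k < n"
    then have "r0 n - k = Suc (r0 n - Suc k)" using seq_suble[OF r0(1), of n] by simp
    then show "T ((T ^^ (r0 n - Suc k)) p) = (T ^^ (r0 n - k)) p" by simp
    have "W ((T ^^ (r0 n - Suc k)) p) \<le> \<sigma> * M\<^sup>2" by (rule W_orbit_le[OF M])
    also have "\<dots> \<le> \<sigma> * M\<^sup>2 * exp (2 * \<nu> * \<sigma> * real k)"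
      using mult_left_mono[of 1 "exp (2 * \<nu> * \<sigma> * real k)" "\<sigma> * M\<^sup>2"] pos by simp
    finally show "W ((T ^^ (r0 n - Suc k)) p) \<le> \<sigma> * M\<^sup>2 * exp (2 * \<nu> * \<sigma> * real k)" .
  qed
  moreover have "convergent (\<lambda>n. pr ((T ^^ (r0 n - 0)) p))" using r0(2) by simp
  ultimately obtain r u where r: "strict_mono (r::nat\<Rightarrow>nat)" "(\<lambda>n. (T ^^ (r0 (r n) - 0)) p) \<longlonglongrightarrow> u" "amenable u"
    by (rule chain_limit)
  have "norm ((T ^^ k) u) \<le> M" for k
  proof -
    have "(\<lambda>n. (T ^^ k) ((T ^^ r0 (r n)) p)) \<longlonglongrightarrow> (T ^^ k) u"
      using r(2) by (induction k) (auto intro: T_tendsto)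
    then have "(\<lambda>n. norm ((T ^^ k) ((T ^^ r0 (r n)) p))) \<longlonglongrightarrow> norm ((T ^^ k) u)" by (rule tendsto_norm)
    moreover have "norm ((T ^^ k) ((T ^^ r0 (r n)) p)) \<le> M" for n
      using Tp[of "k + r0 (r n)"] by (simp add: funpow_add)
    ultimately show ?thesis using LIMSEQ_le_const2 by blast
  qed
  then show ?thesis using r(3) by blast
qed

text \<open>This is the continuity of the inverse of the projection on amenable points. By
  \<open>backward_separation\<close>, closeness of projections forces mean square closeness over the
  preceding period; at a suitable time there the states converge, and \<open>S_factor\<close>
  carries this to the end of the period.\<close>

lemma amenable_subseq_tendsto:
  assumes u: "amenable u" "\<And>n. amenable (u' n)" and lim: "(\<lambda>n. pr (u' n)) \<longlonglongrightarrow> pr u"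
  shows "\<exists>r::nat\<Rightarrow>nat. strict_mono r \<and> (\<lambda>n. u' (r n)) \<longlonglongrightarrow> u"
proof -
  obtain C z where z: "backward u C z" using u(1) by (auto simp: amenable_def)
  have "\<forall>n. \<exists>p. backward (u' n) (fst p) (snd p)" using u(2) by (simp add: amenable_def)
  from choice[OF this] obtain p where p: "\<And>n. backward (u' n) (fst (p n)) (snd (p n))" by blast
  define v where "v = z 1"
  define v' where "v' = (\<lambda>n. snd (p n) 1)"
  have v: "T v = u" "\<And>n. T (v' n) = u' n" using z p by (auto simp: v_def v'_def backward_def)
  define k where "k = Cp / (\<delta> * exp (- 2 * \<nu> * \<sigma>))"
  have D: "D (v' n) v \<le> k * (norm (pr (u' n) - pr u))\<^sup>2" for n
  proof -
    have "\<delta> * exp (- 2 * \<nu> * \<sigma>) * D (v' n) v \<le> - V (u' n - u)"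
      unfolding v_def v'_def by (rule backward_separation[OF p z])
    also have "\<dots> \<le> Cp * (norm (pr (u' n) - pr u))\<^sup>2" using form_lower[of "u' n - u"] by (simp add: pr_diff)
    finally show ?thesis using pos by (simp add: k_def field_simps)
  qed
  have "(\<lambda>n. k * (norm (pr (u' n) - pr u))\<^sup>2) \<longlonglongrightarrow> k * (norm (pr u - pr u))\<^sup>2"
    by (intro tendsto_intros lim)
  then have "(\<lambda>n. k * (norm (pr (u' n) - pr u))\<^sup>2) \<longlonglongrightarrow> 0" by simp
  then have lim0: "(\<lambda>n. D (v' n) v) \<longlonglongrightarrow> 0"
    by (rule tendsto_sandwich[OF _ _ tendsto_const, rotated 2]) (simp_all add: D D_nonneg)
  obtain t and r :: "nat \<Rightarrow> nat" where t: "t \<in> {0..\<sigma>}" "strict_mono r" "(\<lambda>n. (norm (S t (v' (r n)) - S t v))\<^sup>2) \<longlonglongrightarrow> 0"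
  proof (rule integral_tendsto_0_subseq[of 0 \<sigma> "\<lambda>n t. (norm (S t (v' n) - S t v))\<^sup>2"])
    show "continuous_on {0..\<sigma>} (\<lambda>t. (norm (S t (v' n) - S t v))\<^sup>2)" for n
      by (intro continuous_intros S_cont_t) auto
    show "(\<lambda>n. integral {0..\<sigma>} (\<lambda>t. (norm (S t (v' n) - S t v))\<^sup>2)) \<longlonglongrightarrow> 0"
      using lim0 by (simp add: D_def)
  qed (use pos in auto)
  have "(\<lambda>n. sqrt ((norm (S t (v' (r n)) - S t v))\<^sup>2)) \<longlonglongrightarrow> sqrt 0" by (intro tendsto_real_sqrt t)
  then have lim_t: "(\<lambda>n. S t (v' (r n))) \<longlonglongrightarrow> S t v"
    by (simp add: tendsto_norm_zero_iff LIM_zero_iff)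
  obtain h where h: "continuous_on UNIV h" "\<And>w. S \<sigma> w = h (S t w)" using S_factor[of t \<sigma>] t by auto
  have "(\<lambda>n. h (S t (v' (r n)))) \<longlonglongrightarrow> h (S t v)"
    using h(1) lim_t by (auto simp: continuous_on_eq_continuous_at intro: isCont_tendsto_compose)
  then have "(\<lambda>n. u' (r n)) \<longlonglongrightarrow> u" using v by (simp add: h(2)[symmetric] flip: T_def)
  then show ?thesis using t(2) by blast
qed

theorem T_fixed_point:
  assumes M: "\<And>t. 0 \<le> t \<Longrightarrow> norm (S t p) \<le> M"
  shows "\<exists>u. T u = u"
proof -
  have "\<forall>x. \<exists>u. amenable u \<and> pr u = x" using amenable_onto[OF M] by blast
  from choice[OF this] obtain \<Phi> where \<Phi>: "\<And>x. amenable (\<Phi> x)" "\<And>x. pr (\<Phi> x) = x" by blast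
  have \<Phi>_pr: "\<Phi> (pr u) = u" if "amenable u" for u
    using amenable_pr_inj[OF \<Phi>(1) that] \<Phi>(2) by simp
  have \<Phi>c: "continuous_on UNIV \<Phi>"
  proof (rule continuous_on_UNIV_subseqI)
    fix x :: "nat \<Rightarrow> complex" and l assume "x \<longlonglongrightarrow> l"
    then show "\<exists>r::nat\<Rightarrow>nat. strict_mono r \<and> (\<lambda>n. \<Phi> (x (r n))) \<longlonglongrightarrow> \<Phi> l"
      using amenable_subseq_tendsto[of "\<Phi> l" "\<lambda>n. \<Phi> (x n)"] \<Phi> by simp
  qed
  define f where "f = (\<lambda>x. pr (T (\<Phi> x)))"
  have \<Phi>f: "\<Phi> (f x) = T (\<Phi> x)" for x unfolding f_def by (rule \<Phi>_pr[OF amenable_T[OF \<Phi>(1)]])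
  define U where "U = {p::complex \<times> complex. fst p \<noteq> snd p}"
  \<comment> \<open>At \<open>t = 0\<close> the quotient is 1 because \<open>\<Phi>\<close> is a
    right inverse of \<open>pr\<close>; at \<open>t = 1\<close> it is the difference quotient of
    \<open>f\<close>.\<close>
  define g where "g = (\<lambda>(t, p). (pr (S (t * \<sigma>) (\<Phi> (fst p))) - pr (S (t * \<sigma>) (\<Phi> (snd p)))) / (fst p - snd p))"
  have gne: "pr (S t (\<Phi> x)) \<noteq> pr (S t (\<Phi> y))" if "x \<noteq> y" "0 \<le> t" for t x y
  proof (cases "t = 0")
    case True
    then show ?thesis using that \<Phi>(2) by (simp add: S_0)
  next
    case False
    have ne: "\<Phi> x \<noteq> \<Phi> y" using that(1) \<Phi>(2) by metis
    then have "V (\<Phi> x - \<Phi> y) < 0" using amenable_separation \<Phi>(1) by blast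
    then have "V (S t (\<Phi> x) - S t (\<Phi> y)) < 0" using form_neg[OF _ ne, of t] that(2) False by simp
    from form_neg_pr[OF this] show ?thesis by (simp add: pr_diff)
  qed
  have \<Phi>S: "continuous_on A (\<lambda>q. pr (S (a q * \<sigma>) (\<Phi> (b q))))"
    if "continuous_on A a" "continuous_on A b" "\<And>q. q \<in> A \<Longrightarrow> 0 \<le> a q"
    for A :: "(real \<times> complex \<times> complex) set" and a b
  proof -
    have "continuous_on A (\<lambda>q. \<Phi> (b q))" by (rule continuous_on_compose2[OF \<Phi>c that(2)]) simp
    then have "continuous_on A (\<lambda>q. S (a q * \<sigma>) (\<Phi> (b q)))"
      by (intro S_cont_compose continuous_on_mult_right that(1)) (use that(3) pos in auto)
    then show ?thesis by (rule bounded_linear.continuous_on[OF pr])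
  qed
  have gc: "continuous_on ({0..1} \<times> U) g" unfolding g_def split_beta
    by (intro continuous_intros \<Phi>S) (auto simp: U_def)
  have g0: "g \<in> ({0..1} \<times> U) \<rightarrow> - {0}"
    using gne pos by (auto simp: g_def U_def)
  \<comment> \<open>\<open>U\<close> is not simply connected, so the logarithm is obtained by
    lifting the homotopy from the constant 1, starting at 0.\<close>
  obtain k where k: "continuous_on ({0..1} \<times> U) k" "\<And>p. p \<in> U \<Longrightarrow> k (0, p) = 0"
    "\<And>q. q \<in> {0..1} \<times> U \<Longrightarrow> g q = exp (k q)"
  proof (rule covering_space_lift_homotopy[OF covering_space_exp_punctured_plane gc g0, of "\<lambda>_. 0"])
    show "g (0, y) = exp 0" if "y \<in> U" for y using that \<Phi>(2) by (auto simp: g_def U_def S_0)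
  qed auto
  define R where "R = (\<lambda>p. k (1, p))"
  have "rotation_of f R" unfolding rotation_of_def
  proof (intro conjI allI impI)
    show "continuous_on UNIV f" unfolding f_def T_def
      by (intro bounded_linear.continuous_on[OF pr] S_cont_compose continuous_intros \<Phi>c) (use pos in auto)
    show "continuous_on {p. fst p \<noteq> snd p} R" unfolding R_def U_def[symmetric]
      by (intro continuous_on_compose2[OF k(1)] continuous_intros) auto
    fix x y :: complex assume xy: "x \<noteq> y"
    then have U: "(x, y) \<in> U" "(y, x) \<in> U" by (auto simp: U_def)
    have "g (1, (x, y)) = exp (R (x, y))" using k(3) U by (simp add: R_def)
    then show "f x - f y = exp (R (x, y)) * (x - y)" using xy by (simp add: g_def f_def T_def field_simps)
    \<comment> \<open>The quotient is unchanged when \<open>x\<close> and \<open>y\<close> are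
      exchanged, so the two lifts differ by a constant along the isotopy, and they agree at its
      start.\<close>
    have "k (1, (x, y)) - k (1, (y, x)) = k (0, (x, y)) - k (0, (y, x))"
    proof (rule exp_constant_imp_constant[of "{0..1}" "\<lambda>t. k (t, (x, y)) - k (t, (y, x))" 1])
      show "continuous_on {0..1} (\<lambda>t. k (t, (x, y)) - k (t, (y, x)))"
        by (intro continuous_intros continuous_on_compose2[OF k(1)]) (use U in auto)
      show "exp (k (t, (x, y)) - k (t, (y, x))) = 1" if "t \<in> {0..1}" for t
      proof -
        have "g (t, (x, y)) = g (t, (y, x))" using xy by (simp add: g_def divide_eq_eq minus_divide_left[symmetric] field_simps)
        moreover have "g (t, (x, y)) = exp (k (t, (x, y)))" "g (t, (y, x)) = exp (k (t, (y, x)))"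
          using k(3) U that by auto
        ultimately show ?thesis by (simp add: exp_diff)
      qed
    qed auto
    then show "R (x, y) = R (y, x)" using k(2) U by (simp add: R_def)
  qed
  moreover obtain u where u: "amenable u" "\<And>n. norm ((T ^^ n) u) \<le> M"
    using amenable_bounded_orbit[OF M] by blast
  have am: "amenable ((T ^^ n) u)" for n by (induction n) (auto intro: u(1) amenable_T)
  have fn: "(f ^^ n) (pr u) = pr ((T ^^ n) u)" for n
  proof (induction n)
    case (Suc n)
    then show ?case by (simp add: f_def \<Phi>_pr[OF am])
  qed simp
  have "bounded (range (\<lambda>n. (f ^^ n) (pr u)))"
  proof -
    obtain B where B: "\<And>u. norm (pr u) \<le> norm u * B" "B > 0"
      using bounded_linear.pos_bounded[OF pr] by blast
    show ?thesis unfolding bounded_iff fn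
      using order_trans[OF B(1) mult_right_mono[OF u(2) less_imp_le[OF B(2)]]] by blast
  qed
  ultimately obtain x where "f x = x" using bounded_orbit_fixed_point by blast
  then have "T (\<Phi> x) = \<Phi> x" using \<Phi>f[of x] by simp
  then show ?thesis ..
qed

end

section \<open>Periodic cocycles\<close>

lemma orthonormal_basis_2:
  fixes H :: "'h::real_inner set"
  assumes H: "subspace H" "dim H = 2"
  obtains e1 e2 where "e1 \<in> H" "e2 \<in> H" "norm e1 = 1" "norm e2 = 1" "e1 \<bullet> e2 = 0" "H \<subseteq> span {e1, e2}"
proof -
  obtain B where B: "B \<subseteq> H" "independent B" "H \<subseteq> span B" "card B = 2"
    using basis_exists[of H] H(2) by metis
  then obtain b1 b2 where b: "B = {b1, b2}" "b1 \<noteq> b2" by (meson card_2_iff)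
  have b1: "b1 \<noteq> 0" using B(2) b(1) dependent_zero by blast
  define e1 where "e1 = b1 /\<^sub>R norm b1"
  define d where "d = b2 - (b2 \<bullet> e1) *\<^sub>R e1"
  have b2: "b2 \<notin> span {b1}" using B(2) b by (simp add: independent_insert insert_commute[of b1 b2])
  have d: "d \<noteq> 0"
  proof
    assume "d = 0"
    then have "b2 = ((b2 \<bullet> e1) / norm b1) *\<^sub>R b1" by (simp add: d_def e1_def divide_inverse)
    then have "b2 \<in> span {b1}" by (metis span_base span_mul singletonI)
    then show False using b2 by simp
  qed
  define e2 where "e2 = d /\<^sub>R norm d"
  have n: "norm e1 = 1" "norm e2 = 1" using b1 d by (auto simp: e1_def e2_def)
  have "e1 \<bullet> e1 = 1" using n(1) by (simp add: dot_square_norm)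
  then have "e1 \<bullet> d = 0" by (simp add: d_def inner_diff_right inner_commute)
  then have o: "e1 \<bullet> e2 = 0" by (simp add: e2_def)
  have e1: "e1 \<in> H" unfolding e1_def using H(1) B(1) b by (auto intro: subspace_scale)
  then have "d \<in> H" unfolding d_def using H(1) B(1) b by (auto intro: subspace_scale subspace_diff)
  then have e2: "e2 \<in> H" unfolding e2_def using H(1) by (auto intro: subspace_scale)
  have s1: "e1 \<in> span {e1, e2}" "e2 \<in> span {e1, e2}" by (auto intro: span_base)
  have "b1 = norm b1 *\<^sub>R e1" using b1 by (simp add: e1_def)
  then have "b1 \<in> span {e1, e2}" by (metis s1(1) span_mul)
  moreover have "b2 = norm d *\<^sub>R e2 + (b2 \<bullet> e1) *\<^sub>R e1" using d by (simp add: e2_def d_def)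
  then have "b2 \<in> span {e1, e2}" by (metis s1 span_mul span_add)
  ultimately have "span B \<subseteq> span {e1, e2}" unfolding b by (intro span_minimal) auto
  then show thesis using that[OF e1 e2 n o] B(3) by blast
qed

text \<open>Orthogonality and invariance remove the mixed terms of the form. The \<open>H^+\<close>
  part is nonnegative, so the lower bound involves only the \<open>H^-\<close> component, which has
  the norm of the projection.\<close>

lemma plane_coordinates:
  fixes P :: "'h::real_inner \<Rightarrow> 'h"
  assumes P: "bounded_linear P"
    and decomposition: "orthogonal_direct_sum Hplus Hminus"
    and invariant: "P ` Hplus \<subseteq> Hplus" "P ` Hminus \<subseteq> Hminus"
    and sign: "negative_on P Hminus" "positive_on P Hplus"
    and dim: "dim Hminus = 2"
  obtains K c :: real and pr :: "'h \<Rightarrow> complex" and J :: "complex \<Rightarrow> 'h" where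
    "0 < K" "0 < c" "bounded_linear pr" "bounded_linear J" "\<And>z. pr (J z) = z"
    "\<And>u. - K * (norm (pr u))\<^sup>2 \<le> quad_form P u" "\<And>u. quad_form P u \<le> K * (norm u)\<^sup>2"
    "\<And>z. quad_form P (J z) \<le> - c * (norm z)\<^sup>2"
proof -
  have sub: "subspace Hplus" "subspace Hminus" and orth: "\<And>x y. x \<in> Hplus \<Longrightarrow> y \<in> Hminus \<Longrightarrow> x \<bullet> y = 0"
    and sum: "{x + y | x y. x \<in> Hplus \<and> y \<in> Hminus} = UNIV"
    using decomposition by (auto simp: orthogonal_direct_sum_def orthogonal_def)
  obtain e1 e2 where e: "e1 \<in> Hminus" "e2 \<in> Hminus" "norm e1 = 1" "norm e2 = 1" "e1 \<bullet> e2 = 0"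
    "Hminus \<subseteq> span {e1, e2}" using orthonormal_basis_2[OF sub(2) dim] by blast
  have e': "e1 \<bullet> e1 = 1" "e2 \<bullet> e2 = 1" "e2 \<bullet> e1 = 0" using e by (auto simp: dot_square_norm inner_commute)
  define pr where "pr = (\<lambda>u. Complex (u \<bullet> e1) (u \<bullet> e2))"
  define J where "J = (\<lambda>z. Re z *\<^sub>R e1 + Im z *\<^sub>R e2)"
  have pr_alt: "pr = (\<lambda>u. of_real (u \<bullet> e1) + \<i> * of_real (u \<bullet> e2))"
    by (auto simp: pr_def complex_eq_iff)
  have pr: "bounded_linear pr" unfolding pr_alt
    by (intro bounded_linear_add bounded_linear_compose[OF bounded_linear_of_real]
        bounded_linear_compose[OF bounded_linear_mult_right] bounded_linear_inner_left)
  have J: "bounded_linear J" unfolding J_def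
    by (intro bounded_linear_add bounded_linear_compose[OF bounded_linear_scaleR_left] bounded_linear_Re bounded_linear_Im)
  have prJ: "pr (J z) = z" for z
    using e e' by (simp add: pr_def J_def inner_add_left complex_eq_iff)
  have J_in: "J z \<in> Hminus" for z unfolding J_def using e sub(2) by (intro subspace_add subspace_scale) auto
  have J_norm: "norm (J z) = norm z" for z
  proof -
    have "(norm (J z))\<^sup>2 = (norm z)\<^sup>2"
      using e e' by (simp add: power2_norm_eq_inner J_def inner_add_left inner_add_right inner_complex_def)
    then show ?thesis by simp
  qed
  have J_onto: "J (pr y) = y" if y: "y \<in> Hminus" for y
  proof -
    have "y \<in> span {e1, e2}" using e(6) y by blast
    then obtain a where "y - a *\<^sub>R e1 \<in> span {e2}" by (auto simp: span_breakdown_eq)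
    then obtain b where "y - a *\<^sub>R e1 = b *\<^sub>R e2" by (auto simp: span_singleton)
    then have "y = a *\<^sub>R e1 + b *\<^sub>R e2" by (simp add: algebra_simps)
    then have "y = J (Complex a b)" by (simp add: J_def)
    then show ?thesis by (simp add: prJ)
  qed
  obtain K where K: "\<And>u. norm (P u) \<le> norm u * K" "K > 0" using bounded_linear.pos_bounded[OF P] by blast
  have abs: "\<bar>quad_form P u\<bar> \<le> K * (norm u)\<^sup>2" for u
  proof -
    have "\<bar>P u \<bullet> u\<bar> \<le> norm (P u) * norm u" by (rule Cauchy_Schwarz_ineq2)
    also have "\<dots> \<le> norm u * K * norm u" by (intro mult_right_mono K) auto
    finally show ?thesis by (simp add: quad_form_def power2_eq_square mult_ac)
  qed
  have lower: "- K * (norm (pr u))\<^sup>2 \<le> quad_form P u" for u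
  proof -
    obtain x y where u: "u = x + y" "x \<in> Hplus" "y \<in> Hminus" using sum by blast
    have "P x \<in> Hplus" "P y \<in> Hminus" using invariant u by auto
    then have "P x \<bullet> y = 0" "P y \<bullet> x = 0" 
      using orth[of "P x" y] orth[of x "P y"] u(2,3) by (simp_all add: inner_commute)
    then have "quad_form P u = quad_form P x + quad_form P y"
      using P by (simp add: quad_form_def u(1) linear_add bounded_linear.linear inner_add_left inner_add_right)
    moreover have "quad_form P x \<ge> 0"
      using sign(2) u(2) P by (cases "x = 0") (auto simp: positive_on_def quad_form_def less_imp_le)
    moreover have "- (K * (norm y)\<^sup>2) \<le> quad_form P y" using abs[of y] by simp
    moreover have "pr u = pr y" using orth[OF u(2)] e by (simp add: u(1) pr_def inner_add_left)
    then have "norm (pr u) = norm y" using J_norm[of "pr y"] J_onto[OF u(3)] by simp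
    ultimately show ?thesis by simp
  qed
  \<comment> \<open>Compactness of the circle makes the maximum of the form on unit vectors of
    \<open>H^-\<close> attained, hence strictly negative; its negative is the constant
    \<open>c\<close>.\<close>
  define q where "q = (\<lambda>z. quad_form P (J z))"
  have "continuous_on (sphere 0 1) q" unfolding q_def quad_form_def
    by (intro continuous_intros bounded_linear.continuous_on[OF P] bounded_linear.continuous_on[OF J])
  moreover have "1 \<in> sphere (0::complex) 1" by simp
  ultimately have "\<exists>x\<in>sphere 0 1. \<forall>y\<in>sphere 0 1. q y \<le> q x"
    by (intro continuous_attains_sup compact_sphere) blast+
  then obtain z0 where z0: "norm z0 = 1" "\<And>z. norm z = 1 \<Longrightarrow> q z \<le> q z0"
    by (auto simp: sphere_def)
  have "J z0 \<noteq> 0" using J_norm[of z0] z0(1) by auto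
  then have q0: "q z0 < 0" using sign(1) J_in by (auto simp: negative_on_def q_def quad_form_def)
  have scale: "q (a *\<^sub>R z) = a\<^sup>2 * q z" for a z
    using P J by (simp add: q_def quad_form_def linear_scale bounded_linear.linear power2_eq_square)
  have "q z \<le> - (- q z0) * (norm z)\<^sup>2" for z
  proof (cases "z = 0")
    case True
    then show ?thesis using scale[of 0 0] by simp
  next
    case False
    have "q z = (norm z)\<^sup>2 * q (z /\<^sub>R norm z)" using scale[of "norm z" "z /\<^sub>R norm z"] False by simp
    also have "\<dots> \<le> (norm z)\<^sup>2 * q z0" by (intro mult_left_mono z0) (use False in auto)
    finally show ?thesis by (simp add: mult.commute)
  qed
  then show thesis
    using that[of K "- q z0" pr J, OF K(2) _ pr J prJ lower] abs q0 by (auto simp: q_def abs_le_iff)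
qed

section \<open>From the cocycle to one phase and back\<close>

lemma circle_coset_periodic: "circle_coset \<sigma> (x + real n * \<sigma>) = circle_coset \<sigma> x"
  by (rule circle_coset_eqI) (auto simp: circle_coset_def intro!: exI[of _ "int n"])

lemma compact_map_subseq:
  assumes "is_compact_map f" "bounded (range y)"
  shows "\<exists>r::nat\<Rightarrow>nat. strict_mono r \<and> convergent (\<lambda>n. f (y (r n)))"
proof -
  have c: "compact (closure (f ` range y))" using assms by (simp add: is_compact_map_def)
  have "\<forall>n. f (y n) \<in> closure (f ` range y)" using closure_subset[of "f ` range y"] by auto
  then obtain l and r :: "nat \<Rightarrow> nat" where r: "strict_mono r" "((\<lambda>n. f (y n)) \<circ> r) \<longlonglongrightarrow> l"
    by (rule seq_compactE[OF compact_imp_seq_compact[OF c]])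
  from r(2) have "convergent (\<lambda>n. f (y (r n)))" unfolding comp_def by (rule convergentI)
  with r(1) show ?thesis by blast
qed

lemma cocycle_continuous_on:
  assumes "is_cocycle Q \<theta> \<psi>" "q \<in> mspace Q"
  shows "continuous_on ({0..} \<times> UNIV) (\<lambda>(t, u). \<psi> t q u)"
proof -
  have c: "continuous_map (prod_topology (top_of_set {0..}) (prod_topology (mtopology_of Q) euclidean)) euclidean
       (\<lambda>(t, q, u). \<psi> t q u)" using assms(1) by (simp add: is_cocycle_def)
  have "continuous_map (prod_topology (top_of_set {0..}) euclidean)
     (prod_topology (top_of_set {0..}) (prod_topology (mtopology_of Q) euclidean)) (\<lambda>p. (fst p, q, snd p))"
    by (intro continuous_map_pairedI continuous_map_fst continuous_map_snd) (use assms(2) in simp)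
  from continuous_map_compose[OF this c]
  have "continuous_map (prod_topology (top_of_set {0..}) euclidean) euclidean (\<lambda>p. \<psi> (fst p) q (snd p))"
    by (simp add: comp_def)
  moreover have "prod_topology (top_of_set {0::real..}) (euclidean::'b topology) = top_of_set ({0..} \<times> UNIV)"
    using prod_topology_subtopology(1)[of euclidean "{0::real..}" "euclidean::'b topology"] by simp
  ultimately show ?thesis by (simp add: split_beta)
qed

text \<open>The forward orbit of \<open>u\<close> is \<sigma>-periodic, so it extends to negative
  times by adding enough periods.\<close>

lemma fixed_point_periodic_trajectory:
  fixes \<psi> :: "real \<Rightarrow> real set \<Rightarrow> 'h \<Rightarrow> 'h::topological_space"
  assumes \<sigma>: "0 < \<sigma>" and cocycle: "is_periodic_cocycle \<sigma> \<theta> \<psi>"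
    and q: "q = circle_coset \<sigma> x" and u: "\<psi> \<sigma> q u = u"
  shows "\<exists>w. is_periodic_trajectory \<sigma> \<theta> \<psi> q w"
proof -
  have co: "is_cocycle (circle \<sigma>) \<theta> \<psi>" and th: "\<And>t x. \<theta> t (circle_coset \<sigma> x) = circle_coset \<sigma> (x + t)"
    using cocycle by (auto simp: is_periodic_cocycle_def)
  have qm: "circle_coset \<sigma> y \<in> mspace (circle \<sigma>)" for y using \<sigma> by simp
  have add: "\<psi> (t + s) (circle_coset \<sigma> y) v = \<psi> t (circle_coset \<sigma> (y + s)) (\<psi> s (circle_coset \<sigma> y) v)"
    if "0 \<le> t" "0 \<le> s" for t s y v using co qm that by (simp add: is_cocycle_def flip: th)
  have step: "\<psi> (t + real n * \<sigma>) q u = \<psi> t q u" if "0 \<le> t" for t n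
  proof (induction n)
    case (Suc n)
    have "\<psi> (t + real (Suc n) * \<sigma>) q u = \<psi> ((t + real n * \<sigma>) + \<sigma>) q u" by (simp add: algebra_simps)
    also have "\<dots> = \<psi> (t + real n * \<sigma>) q u"
      using add[of "t + real n * \<sigma>" \<sigma> x u] that \<sigma> circle_coset_periodic[of \<sigma> x 1] u by (simp add: q)
    finally show ?case using Suc by simp
  qed simp
  \<comment> \<open>The rounded-up quotient is one admissible number of periods; the next fact shows
    that any other gives the same value, so a fixed \<open>n\<close> can be used near each
    time.\<close>
  define w where "w = (\<lambda>t. \<psi> (t + real (nat \<lceil>\<bar>t\<bar> / \<sigma>\<rceil>) * \<sigma>) q u)"
  have w: "w t = \<psi> (t + real n * \<sigma>) q u" if n: "0 \<le> t + real n * \<sigma>" for t n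
  proof -
    define m where "m = nat \<lceil>\<bar>t\<bar> / \<sigma>\<rceil>"
    have "\<bar>t\<bar> / \<sigma> \<le> real m" unfolding m_def by linarith
    then have m: "0 \<le> t + real m * \<sigma>" using \<sigma> by (simp add: field_simps) 
    have "\<psi> (t + real n * \<sigma>) q u = \<psi> (t + real n * \<sigma> + real m * \<sigma>) q u" using step[OF n] by simp
    also have "\<dots> = \<psi> (t + real m * \<sigma> + real n * \<sigma>) q u" by (simp add: algebra_simps)
    also have "\<dots> = \<psi> (t + real m * \<sigma>) q u" using step[OF m] by simp
    finally show ?thesis by (simp add: w_def m_def)
  qed
  have ex: "\<exists>n. 0 < t + real n * \<sigma>" for t
  proof -
    obtain n :: nat where "- t / \<sigma> < real n" using reals_Archimedean2 by blast
    then show ?thesis using \<sigma> by (intro exI[of _ n]) (simp add: field_simps)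
  qed
  have "continuous_on UNIV w"
  proof (rule continuous_at_imp_continuous_on, rule ballI)
    fix t
    obtain n where n: "0 < t + real n * \<sigma>" using ex by blast
    have "continuous_on {- (real n * \<sigma>)<..} (\<lambda>t. \<psi> (t + real n * \<sigma>) q u)"
    proof -
      have "continuous_on {- (real n * \<sigma>)<..} (\<lambda>t. case (t + real n * \<sigma>, u) of (t, u) \<Rightarrow> \<psi> t (circle_coset \<sigma> x) u)"
        by (rule continuous_on_compose2[OF cocycle_continuous_on[OF co qm]]) (auto intro!: continuous_intros)
      then show ?thesis by (simp add: q)
    qed
    then have "continuous_on {- (real n * \<sigma>)<..} w"
    proof (rule continuous_on_eq)
      show "\<psi> (s + real n * \<sigma>) q u = w s" if "s \<in> {- (real n * \<sigma>)<..}" for s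
        using w[of s n] that by simp
    qed
    then show "isCont w t" using n by (simp add: continuous_on_eq_continuous_at)
  qed
  moreover have "w (t + s) = \<psi> t (\<theta> s q) (w s)" if "0 \<le> t" for t s
  proof -
    obtain n where n: "0 < s + real n * \<sigma>" using ex by blast
    have "w (t + s) = \<psi> (t + (s + real n * \<sigma>)) q u" using w[of "t + s" n] n that by (simp add: add.assoc)
    also have "\<dots> = \<psi> t (circle_coset \<sigma> (x + (s + real n * \<sigma>))) (\<psi> (s + real n * \<sigma>) q u)"
      using add[of t "s + real n * \<sigma>" x u] n that by (simp add: q)
    also have "circle_coset \<sigma> (x + (s + real n * \<sigma>)) = \<theta> s q"
      using circle_coset_periodic[of \<sigma> "x + s" n] by (simp add: q th add.assoc)
    finally show ?thesis using w[of s n] n by simp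
  qed
  moreover have "w (t + \<sigma>) = w t" for t
  proof -
    obtain n where n: "0 < t + real n * \<sigma>" using ex by blast
    then show ?thesis using w[of "t + \<sigma>" n] w[of t "Suc n"] \<sigma> by (simp add: algebra_simps)
  qed
  ultimately have "is_periodic_trajectory \<sigma> \<theta> \<psi> q w"
    by (simp add: is_periodic_trajectory_def is_complete_trajectory_def)
  then show ?thesis by blast
qed

theorem theorem4:
  fixes \<sigma> \<delta> \<nu> :: real
    and \<theta> :: "real \<Rightarrow> real set \<Rightarrow> real set"
    and \<psi> :: "real \<Rightarrow> real set \<Rightarrow> 'h \<Rightarrow> 'h::{real_inner, complete_space}"
    and P :: "'h \<Rightarrow> 'h"
    and Hplus Hminus :: "'h set"
  assumes separable: "separable_space (euclidean :: 'h topology)"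
    and sigma: "\<sigma> > 0"
    and cocycle: "is_periodic_cocycle \<sigma> \<theta> \<psi>"
    and P: "bounded_linear P" "self_adjoint P"
    and decomposition: "orthogonal_direct_sum Hplus Hminus"
    and invariant: "P ` Hplus \<subseteq> Hplus" "P ` Hminus \<subseteq> Hminus"
    and sign: "negative_on P Hminus" "positive_on P Hplus"
    and dim: "dim Hminus = 2"
    and delta_nu: "\<delta> > 0" "\<nu> > 0"
    and squeezing: "\<And>u v q l r. q \<in> mspace (circle \<sigma>) \<Longrightarrow> 0 \<le> l \<Longrightarrow> l \<le> r \<Longrightarrow>
        exp (2 * \<nu> * r) * quad_form P (\<psi> r q u - \<psi> r q v)
          - exp (2 * \<nu> * l) * quad_form P (\<psi> l q u - \<psi> l q v)
        \<le> - \<delta> * integral {l..r} (\<lambda>s. exp (2 * \<nu> * s) * (norm (\<psi> s q u - \<psi> s q v))\<^sup>2)"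
    and compactness: "is_compact_map P \<or>
        (\<exists>t_com>0. \<forall>q\<in>mspace (circle \<sigma>). is_compact_map (\<psi> t_com q))"
    and bounded_semitrajectory:
        "\<exists>q\<in>mspace (circle \<sigma>). \<exists>u\<^sub>0. bounded ((\<lambda>t. \<psi> t q u\<^sub>0) ` {0..})"
  shows "\<exists>q\<in>mspace (circle \<sigma>). \<exists>u. is_periodic_trajectory \<sigma> \<theta> \<psi> q u"
proof -
  have co: "is_cocycle (circle \<sigma>) \<theta> \<psi>" and th: "\<And>t x. \<theta> t (circle_coset \<sigma> x) = circle_coset \<sigma> (x + t)"
    using cocycle by (auto simp: is_periodic_cocycle_def)
  have qm: "circle_coset \<sigma> y \<in> mspace (circle \<sigma>)" for y using sigma by simp
  have add: "\<psi> (t + s) (circle_coset \<sigma> y) v = \<psi> t (circle_coset \<sigma> (y + s)) (\<psi> s (circle_coset \<sigma> y) v)"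
    if "0 \<le> t" "0 \<le> s" for t s y v using co qm that by (simp add: is_cocycle_def flip: th)
  obtain x p where p: "bounded ((\<lambda>t. \<psi> t (circle_coset \<sigma> x) p) ` {0..})"
    using bounded_semitrajectory sigma by auto
  define q where "q = circle_coset \<sigma> x"
  obtain K c :: real and pr :: "'h \<Rightarrow> complex" and J :: "complex \<Rightarrow> 'h" where J: "0 < K" "0 < c" "bounded_linear pr" "bounded_linear J"
    "\<And>z. pr (J z) = z" "\<And>u. - K * (norm (pr u))\<^sup>2 \<le> quad_form P u" "\<And>u. quad_form P u \<le> K * (norm u)\<^sup>2"
    "\<And>z. quad_form P (J z) \<le> - c * (norm z)\<^sup>2"
    by (rule plane_coordinates[OF P(1) decomposition invariant sign dim]) (rule that, assumption+)
  interpret squeezed_semiflow "\<lambda>t. \<psi> t q" P pr J \<sigma> \<delta> \<nu> K c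
  proof (rule squeezed_semiflow.intro)
    show "\<psi> 0 q u = u" for u using co qm by (simp add: is_cocycle_def q_def)
    show "\<psi> (t + \<sigma>) q u = \<psi> t q (\<psi> \<sigma> q u)" if "0 \<le> t" for t u
      using add[of t \<sigma> x u] that sigma circle_coset_periodic[of \<sigma> x 1] by (simp add: q_def)
    show "continuous_on ({0..} \<times> UNIV) (\<lambda>(t, u). \<psi> t q u)"
      unfolding q_def by (rule cocycle_continuous_on[OF co qm])
    show "\<exists>h. continuous_on UNIV h \<and> (\<forall>u. \<psi> t q u = h (\<psi> s q u))" if st: "0 \<le> s" "s \<le> t" for s t
    proof (intro exI conjI allI)
      have "continuous_on UNIV (\<lambda>u. case (t - s, u) of (t, u) \<Rightarrow> \<psi> t (circle_coset \<sigma> (x + s)) u)"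
        by (rule continuous_on_compose2[OF cocycle_continuous_on[OF co qm]]) (use st in \<open>auto intro!: continuous_intros\<close>)
      then show "continuous_on UNIV (\<psi> (t - s) (circle_coset \<sigma> (x + s)))" by simp
      show "\<psi> t q u = \<psi> (t - s) (circle_coset \<sigma> (x + s)) (\<psi> s q u)" for u
        using add[of "t - s" s x u] st by (simp add: q_def)
    qed
    show "exp (2 * \<nu> * r) * quad_form P (\<psi> r q u - \<psi> r q v) - exp (2 * \<nu> * l) * quad_form P (\<psi> l q u - \<psi> l q v)
        \<le> - \<delta> * integral {l..r} (\<lambda>s. exp (2 * \<nu> * s) * (norm (\<psi> s q u - \<psi> s q v))\<^sup>2)"
      if "0 \<le> l" "l \<le> r" for l r u v using squeezing[OF qm that] unfolding q_def .
    show "(\<forall>y. bounded (range y) \<longrightarrow> (\<exists>r. strict_mono (r::nat\<Rightarrow>nat) \<and> convergent (\<lambda>n. P (y (r n))))) \<or>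
       (\<exists>\<tau>>0. \<forall>s\<ge>0. \<forall>y. bounded (range (\<lambda>n. \<psi> s q (y n))) \<longrightarrow>
           (\<exists>r. strict_mono (r::nat\<Rightarrow>nat) \<and> convergent (\<lambda>n. \<psi> (s + \<tau>) q (y (r n)))))"
      using compactness
    proof
      assume "is_compact_map P"
      then show ?thesis using compact_map_subseq by blast
    next
      assume "\<exists>t_com>0. \<forall>q\<in>mspace (circle \<sigma>). is_compact_map (\<psi> t_com q)"
      then obtain \<tau> where \<tau>: "\<tau> > 0" "\<And>y. is_compact_map (\<psi> \<tau> (circle_coset \<sigma> y))" using qm by blast
      have "\<exists>r. strict_mono (r::nat\<Rightarrow>nat) \<and> convergent (\<lambda>n. \<psi> (s + \<tau>) q (y (r n)))"
        if s: "0 \<le> s" "bounded (range (\<lambda>n. \<psi> s q (y n)))" for s y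
      proof -
        \<comment> \<open>After time \<open>s\<close> the phase has moved to \<open>x + s\<close>,
          so compactness of the time-\<tau> map is used at that phase.\<close>
        have "\<psi> (s + \<tau>) q v = \<psi> \<tau> (circle_coset \<sigma> (x + s)) (\<psi> s q v)" for v
          using add[of \<tau> s x v] s \<tau>(1) by (simp add: q_def add.commute)
        then show ?thesis using compact_map_subseq[OF \<tau>(2) s(2), of "x + s"] by simp
      qed
      then show ?thesis using \<tau>(1) by blast
    qed
  qed (fact sigma delta_nu P J)+
  obtain M where M: "\<And>t. 0 \<le> t \<Longrightarrow> norm (\<psi> t q p) \<le> M"
    using p by (auto simp: bounded_iff q_def)
  obtain u where "\<psi> \<sigma> q u = u" using T_fixed_point[OF M] by (auto simp: T_def)
  then obtain w where "is_periodic_trajectory \<sigma> \<theta> \<psi> q w"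
    using fixed_point_periodic_trajectory[OF sigma cocycle q_def] by blast
  moreover have "q \<in> mspace (circle \<sigma>)" unfolding q_def by (rule qm)
  ultimately show ?thesis by blast
qed

end
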